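(* Let $f$ be a smooth strictly convex function on a domain $\Omega\subset\mathbb{R}^n$, and let $M=\{(x,f(x)) : x\in\Omega\}$ be its graph. Suppose that the Calabi metric $G$ of $M$ is flat and that the cubic form (Fubini-Pick form) $A$ of $M$ is parallel, i.e. $\nabla A=0$, where $\nabla$ is the Levi-Civita connection of $G$. Then $M$ is Calabi affine equivalent to an open part of one of the following hypersurfaces: (i) the elliptic paraboloid; or (ii) one of the hypersurfaces $Q(c_1,\dots,c_r;n)$, with $1\le r\le n$ and $c_1,\dots,c_r>0$.
   Context: A domain is a nonempty connected open set; strictly convex means that the Hessian matrix $(f_{ij})=(\partial^2 f/\partial x_i\partial x_j)$ is positive definite everywhere. The Calabi metric of the graph $M=\{(x,f(x)):x\in\Omega\}$ is the Riemannian metric $G=\sum_{i,j} f_{ij}\,dx_i\,dx_j$ (on $\Omega$, equivalently on $M$, using $(x_1,\dots,x_n)$ as global coordinates). The cubic form (Fubini-Pick form) is the totally symmetric $(0,3)$-tensor $A$ with components $A_{ijk}=-\tfrac12\,\partial^3 f/\partial x_i\partial x_j\partial x_k$ in the coordinates $(x_1,\dots,x_n)$. Two graph hypersurfaces in $\mathbb{R}^{n+1}$ are Calabi affine equivalent if one is the image of the other under an affine transformation of $\mathbb{R}^{n+1}$ of the form $X\mapsto \begin{pmatrix} P & 0\\ q & 1\end{pmatrix}X+b$ with $P\in GL(n,\mathbb{R})$, $q$ a constant row vector of length $n$, and $b\in\mathbb{R}^{n+1}$ (that is, an affine transformation whose linear part fixes $Y=(0,\dots,0,1)^t$). The elliptic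 paraboloid is the graph of $x_{n+1}=\tfrac12\sum_{i=1}^n x_i^2$ over $\mathbb{R}^n$. For $1\le r\le n$ and positive numbers $c_1,\dots,c_r$, the hypersurface $Q(c_1,\dots,c_r;n)$ is the graph of $$x_{n+1}=-\sum_{i=1}^r c_i\ln x_i+\sum_{j=r+1}^n\tfrac12x_j^2$$ over $\{(x_1,\dots,x_n): x_1>0,\dots,x_r>0\}$. *)

theory Defs
  imports "HOL-Analysis.Analysis"
begin

text \<open>
  Coordinates on \<open>real ^ 'n\<close> are indexed by the finite type \<open>'n\<close>, and \<open>R\<^sup>n\<^sup>+\<^sup>1\<close> is
  \<open>(real ^ 'n) \<times> real\<close>, the second component being the last coordinate.
  Tensor fields on an open subset of \<open>real ^ 'n\<close> are given by their components in the global
  coordinates; all the indices are lower ones unless stated otherwise, and the point comes last.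
\<close>

definition partial_deriv :: "'n::finite \<Rightarrow> (real ^ 'n \<Rightarrow> real) \<Rightarrow> real ^ 'n \<Rightarrow> real" where
  "partial_deriv i f x = deriv (\<lambda>t. f (x + t *\<^sub>R axis i 1)) 0"

fun Ck_on :: "nat \<Rightarrow> (real ^ 'n::finite \<Rightarrow> real) \<Rightarrow> (real ^ 'n) set \<Rightarrow> bool" where
  "Ck_on 0 f S \<longleftrightarrow> continuous_on S f"
| "Ck_on (Suc k) f S \<longleftrightarrow> f differentiable_on S \<and> (\<forall>i. Ck_on k (partial_deriv i f) S)"

text \<open>Only used for open sets.\<close>

definition smooth_fun_on :: "(real ^ 'n::finite \<Rightarrow> real) \<Rightarrow> (real ^ 'n) set \<Rightarrow> bool" where
  "smooth_fun_on f S \<longleftrightarrow> (\<forall>k. Ck_on k f S)"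

definition hessian :: "(real ^ 'n::finite \<Rightarrow> real) \<Rightarrow> real ^ 'n \<Rightarrow> real ^ 'n ^ 'n" where
  "hessian f x = (\<chi> i j. partial_deriv i (partial_deriv j f) x)"

definition positive_definite :: "real ^ 'n ^ 'n::finite \<Rightarrow> bool" where
  "positive_definite A \<longleftrightarrow> transpose A = A \<and> (\<forall>v. v \<noteq> 0 \<longrightarrow> v \<bullet> (A *v v) > 0)"

definition strictly_convex_on :: "(real ^ 'n::finite \<Rightarrow> real) \<Rightarrow> (real ^ 'n) set \<Rightarrow> bool" where
  "strictly_convex_on f S \<longleftrightarrow> (\<forall>x\<in>S. positive_definite (hessian f x))"

definition is_domain :: "'a::topological_space set \<Rightarrow> bool" where
  "is_domain S \<longleftrightarrow> S \<noteq> {} \<and> open S \<and> connected S"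

text \<open>
  \<open>christoffel g k i j\<close> is \<open>\<Gamma>\<close> with upper index \<open>k\<close> and lower indices \<open>i\<close>, \<open>j\<close>, the coefficients
  of the Levi-Civita connection of \<open>g\<close>:
  the covariant derivative of the \<open>j\<close>th coordinate field along the \<open>i\<close>th one
  is the sum over \<open>k\<close> of \<open>christoffel g k i j\<close> times the \<open>k\<close>th one.
\<close>

definition christoffel ::
  "(real ^ 'n \<Rightarrow> real ^ 'n ^ 'n) \<Rightarrow> 'n \<Rightarrow> 'n \<Rightarrow> 'n::finite \<Rightarrow> real ^ 'n \<Rightarrow> real" where
  "christoffel g k i j x =
     1 / 2 * (\<Sum>l\<in>UNIV. matrix_inv (g x) $ k $ l *
       (partial_deriv i (\<lambda>y. g y $ j $ l) x + partial_deriv j (\<lambda>y. g y $ i $ l) x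
         - partial_deriv l (\<lambda>y. g y $ i $ j) x))"

text \<open>
  The component along the \<open>l\<close>th coordinate field of \<open>R(X\<^sub>i, X\<^sub>j) X\<^sub>k\<close>, where \<open>X\<^sub>i\<close> is the \<open>i\<close>th
  coordinate field and \<open>R(X,Y)Z = \<nabla>\<^sub>X \<nabla>\<^sub>Y Z - \<nabla>\<^sub>Y \<nabla>\<^sub>X Z - \<nabla>\<^bsub>[X,Y]\<^esub> Z\<close>.
\<close>

definition riemann_curvature ::
  "(real ^ 'n \<Rightarrow> real ^ 'n ^ 'n) \<Rightarrow> 'n \<Rightarrow> 'n \<Rightarrow> 'n \<Rightarrow> 'n::finite \<Rightarrow> real ^ 'n \<Rightarrow> real" where
  "riemann_curvature g l k i j x =
     partial_deriv i (christoffel g l j k) x - partial_deriv j (christoffel g l i k) x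
     + (\<Sum>m\<in>UNIV. christoffel g l i m x * christoffel g m j k x
                 - christoffel g l j m x * christoffel g m i k x)"

definition flat_metric_on ::
  "(real ^ 'n::finite \<Rightarrow> real ^ 'n ^ 'n) \<Rightarrow> (real ^ 'n) set \<Rightarrow> bool" where
  "flat_metric_on g S \<longleftrightarrow> (\<forall>x\<in>S. \<forall>l k i j. riemann_curvature g l k i j x = 0)"

text \<open>The derivative of the (0,3)-tensor \<open>A\<close> in the direction of the \<open>l\<close>th coordinate field.\<close>

definition covariant_deriv3 ::
  "(real ^ 'n \<Rightarrow> real ^ 'n ^ 'n) \<Rightarrow> ('n \<Rightarrow> 'n \<Rightarrow> 'n \<Rightarrow> real ^ 'n \<Rightarrow> real)
    \<Rightarrow> 'n \<Rightarrow> 'n \<Rightarrow> 'n \<Rightarrow> 'n::finite \<Rightarrow> real ^ 'n \<Rightarrow> real" where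
  "covariant_deriv3 g A l i j k x =
     partial_deriv l (A i j k) x
     - (\<Sum>m\<in>UNIV. christoffel g m l i x * A m j k x
                 + christoffel g m l j x * A i m k x
                 + christoffel g m l k x * A i j m x)"

definition parallel3_on ::
  "(real ^ 'n \<Rightarrow> real ^ 'n ^ 'n) \<Rightarrow> ('n \<Rightarrow> 'n \<Rightarrow> 'n::finite \<Rightarrow> real ^ 'n \<Rightarrow> real)
    \<Rightarrow> (real ^ 'n) set \<Rightarrow> bool" where
  "parallel3_on g A S \<longleftrightarrow> (\<forall>x\<in>S. \<forall>l i j k. covariant_deriv3 g A l i j k x = 0)"

definition graph_over :: "(real ^ 'n::finite) set \<Rightarrow> (real ^ 'n \<Rightarrow> real) \<Rightarrow> ((real ^ 'n) \<times> real) set" where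
  "graph_over S f = (\<lambda>x. (x, f x)) ` S"

definition calabi_metric :: "(real ^ 'n::finite \<Rightarrow> real) \<Rightarrow> real ^ 'n \<Rightarrow> real ^ 'n ^ 'n" where
  "calabi_metric f = hessian f"

definition cubic_form ::
  "(real ^ 'n \<Rightarrow> real) \<Rightarrow> 'n \<Rightarrow> 'n \<Rightarrow> 'n::finite \<Rightarrow> real ^ 'n \<Rightarrow> real" where
  "cubic_form f i j k x = - (1 / 2) * partial_deriv i (partial_deriv j (partial_deriv k f)) x"

text \<open>
  The affine map whose linear part is the block matrix with rows \<open>(P, 0)\<close> and \<open>(q, 1)\<close>,
  and whose translation part is \<open>b\<close>.
\<close>

definition calabi_map ::
  "real ^ 'n ^ 'n \<Rightarrow> real ^ 'n \<Rightarrow> (real ^ 'n) \<times> real \<Rightarrow> (real ^ 'n) \<times> real \<Rightarrow> (real ^ 'n::finite) \<times> real" where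
  "calabi_map P q b X = (P *v fst X, q \<bullet> fst X + snd X) + b"

definition calabi_affine_equivalent ::
  "((real ^ 'n::finite) \<times> real) set \<Rightarrow> ((real ^ 'n) \<times> real) set \<Rightarrow> bool" where
  "calabi_affine_equivalent M N \<longleftrightarrow> (\<exists>P q b. invertible P \<and> N = calabi_map P q b ` M)"

definition elliptic_paraboloid :: "((real ^ 'n::finite) \<times> real) set" where
  "elliptic_paraboloid = graph_over UNIV (\<lambda>x. 1 / 2 * (\<Sum>i\<in>UNIV. (x $ i)\<^sup>2))"

text \<open>
  The index type \<open>'n\<close> carries no order, so the numbering of the coordinates is a parameter \<open>e\<close>,
  a bijection from \<open>{1..CARD('n)}\<close> onto \<open>'n\<close>: the coordinate \<open>x\<^sub>i\<close> is \<open>x $ e i\<close>.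
\<close>

definition Q_hypersurface :: "(nat \<Rightarrow> 'n::finite) \<Rightarrow> nat \<Rightarrow> (nat \<Rightarrow> real) \<Rightarrow> ((real ^ 'n) \<times> real) set" where
  "Q_hypersurface e r c =
     graph_over {x. \<forall>i\<in>{1..r}. x $ e i > 0}
       (\<lambda>x. - (\<Sum>i=1..r. c i * ln (x $ e i)) + (\<Sum>j=r+1..CARD('n). 1 / 2 * (x $ e j)\<^sup>2))"

text \<open>Open is meant relative to \<open>N\<close>.\<close>

definition equivalent_to_open_part ::
  "((real ^ 'n::finite) \<times> real) set \<Rightarrow> ((real ^ 'n) \<times> real) set \<Rightarrow> bool" where
  "equivalent_to_open_part M N \<longleftrightarrow>
     (\<exists>U. openin (top_of_set N) U \<and> calabi_affine_equivalent M U)"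

end

theory Submission
  imports Defs
begin

text \<open>
  Let \<open>\<Gamma>\<^sub>i\<close> be the matrix of Christoffel symbols with lower index \<open>i\<close>, so that \<open>\<partial>\<^sub>l g = 2 g \<Gamma>\<^sub>l\<close>.
  For a Hessian metric the curvature operators are the commutators \<open>- [\<Gamma>\<^sub>i, \<Gamma>\<^sub>j]\<close>, so flatness makes the
  \<open>\<Gamma>\<^sub>i\<close> commute, and \<open>\<nabla>A = 0\<close> then becomes \<open>\<partial>\<^sub>l \<Gamma>\<^sub>i = \<Gamma>\<^sub>l \<Gamma>\<^sub>i\<close>.
  Fix a base point \<open>x\<^sub>0\<close>, let \<open>L v\<close> be the linear combination of the \<open>\<Gamma>\<^sub>i(x\<^sub>0)\<close> with coefficients \<open>v\<^sub>i\<close>, and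
  put \<open>E(x) = I - L (x - x\<^sub>0)\<close>. Both sides of \<open>\<Gamma>\<^sub>i E = \<Gamma>\<^sub>i(x\<^sub>0)\<close> agree at \<open>x\<^sub>0\<close> and their difference satisfies
  a homogeneous linear system, so they agree everywhere; consequently \<open>g E\<^sup>2\<close> is constant.

  The product \<open>u v = (L u) v\<close> is commutative, associative and symmetric for the inner product \<open>g(x\<^sub>0)\<close>.
  Splitting off maximisers of the cubic form gives an orthonormal basis of vectors \<open>b\<close> with
  \<open>b b = m\<^sub>b b\<close> and all mixed products zero. In the corresponding coordinates \<open>y\<^sub>b\<close> the metric is diagonal with
  entries \<open>(1 - m\<^sub>b y\<^sub>b)\<^sup>-\<^sup>2\<close>, which is integrated twice: a nonzero \<open>m\<^sub>b\<close> gives a logarithm with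
  \<open>c = m\<^sub>b\<^sup>-\<^sup>2\<close> in the coordinate \<open>1 - m\<^sub>b y\<^sub>b\<close>, and \<open>m\<^sub>b = 0\<close> gives \<open>y\<^sub>b\<^sup>2 / 2\<close>.
\<close>

subsection \<open>Partial derivatives and matrix calculus\<close>

lemma has_derivative_vecI:
  fixes F :: "'a::real_normed_vector \<Rightarrow> 'b::euclidean_space ^ 'm::finite"
  assumes "\<And>i. ((\<lambda>x. F x $ i) has_derivative (\<lambda>h. F' h $ i)) (at x)"
  shows "(F has_derivative F') (at x)"
  unfolding has_derivative_componentwise_within[of F]
  by (auto simp: Basis_vec_def inner_axis intro!: derivative_eq_intros assms)

lemma has_derivative_vec_lambda:
  fixes F :: "'m::finite \<Rightarrow> 'a::real_normed_vector \<Rightarrow> 'b::euclidean_space"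
  assumes "\<And>i. (F i has_derivative F' i) (at x)"
  shows "((\<lambda>x. \<chi> i::'m. F i x) has_derivative (\<lambda>h. \<chi> i. F' i h)) (at x)"
  by (rule has_derivative_vecI) (simp add: assms)

lemma bilinear_matrix_mult: "bilinear (\<lambda>(A::real^'n::finite^'m::finite) (B::real^'k::finite^'n). A ** B)"
  by (auto simp: bilinear_def linear_iff matrix_add_ldistrib scalar_matrix_assoc matrix_scalar_ac
      matrix_matrix_mult_def vec_eq_iff sum.distrib algebra_simps sum_distrib_left)

lemma bounded_bilinear_matrix_mult:
  "bounded_bilinear (\<lambda>(A::real^'n::finite^'m::finite) (B::real^'k::finite^'n). A ** B)"
  using bilinear_matrix_mult bilinear_conv_bounded_bilinear by blast

lemmas has_derivative_matrix_mult = bounded_bilinear.FDERIV[OF bounded_bilinear_matrix_mult]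

lemmas matrix_scaleR = bounded_bilinear.scaleR_left[OF bounded_bilinear_matrix_mult]
  bounded_bilinear.scaleR_right[OF bounded_bilinear_matrix_mult]

lemmas matrix_diff = bounded_bilinear.diff_left[OF bounded_bilinear_matrix_mult]
  bounded_bilinear.diff_right[OF bounded_bilinear_matrix_mult]

lemmas matrix_sum = bounded_bilinear.sum_left[OF bounded_bilinear_matrix_mult]
  bounded_bilinear.sum_right[OF bounded_bilinear_matrix_mult]

lemma has_partial_deriv:
  assumes "(f has_derivative D) (at x)"
  shows "partial_deriv i f x = D (axis i 1)"
proof -
  have "((\<lambda>t. f (x + t *\<^sub>R axis i 1)) has_derivative (\<lambda>t. D (t *\<^sub>R axis i 1))) (at 0)"
    by (rule derivative_eq_intros has_derivative_compose[where f="\<lambda>t. x + t *\<^sub>R axis i 1" and g=f] | simp add: assms)+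
  moreover have "D (t *\<^sub>R axis i 1) = D (axis i 1) * t" for t
    using assms has_derivative_linear linear_scale by (fastforce simp: mult.commute)
  ultimately have "((\<lambda>t. f (x + t *\<^sub>R axis i 1)) has_field_derivative D (axis i 1)) (at 0)"
    by (simp add: has_field_derivative_def)
  then show ?thesis
    unfolding partial_deriv_def by (rule DERIV_imp_deriv)
qed

lemma linear_eq_sum_axis:
  fixes D :: "real^'n::finite \<Rightarrow> 'b::real_vector"
  assumes "linear D" shows "D h = (\<Sum>i\<in>UNIV. h $ i *\<^sub>R D (axis i 1))"
proof -
  have "D h = D (\<Sum>i\<in>UNIV. h $ i *\<^sub>R axis i 1)"
    using basis_expansion[of h] by (simp add: scalar_mult_eq_scaleR)
  then show ?thesis by (simp add: linear_sum[OF assms] linear_scale[OF assms])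
qed

lemma differentiable_imp_has_partials:
  assumes "f differentiable (at x)"
  shows "(f has_derivative (\<lambda>h. \<Sum>i\<in>UNIV. h $ i * partial_deriv i f x)) (at x)"
proof -
  obtain D where D: "(f has_derivative D) (at x)" using assms differentiable_def by blast
  have "D h = (\<Sum>i\<in>UNIV. h $ i * partial_deriv i f x)" for h
    using linear_eq_sum_axis[OF has_derivative_linear[OF D], of h] by (simp add: has_partial_deriv[OF D])
  then have "D = (\<lambda>h. \<Sum>i\<in>UNIV. h $ i * partial_deriv i f x)" by auto
  then show ?thesis using D by simp
qed

text \<open>The line through \<open>x\<close> stays in the open set \<open>S\<close> for small
  parameters. This lets identities that hold only on the domain be differentiated.\<close>

lemma partial_deriv_cong:
  assumes "open S" "x \<in> S" "\<And>y. y \<in> S \<Longrightarrow> f y = g y"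
  shows "partial_deriv i f x = partial_deriv i g x"
proof -
  have "((\<lambda>t::real. x + t *\<^sub>R axis i (1::real)) \<longlongrightarrow> x + 0 *\<^sub>R axis i 1) (nhds 0)"
    by (intro tendsto_intros filterlim_ident)
  then have "eventually (\<lambda>t::real. x + t *\<^sub>R axis i (1::real) \<in> S) (nhds 0)"
    using assms(1,2) by (auto dest: topological_tendstoD)
  then have "eventually (\<lambda>t. f (x + t *\<^sub>R axis i 1) = g (x + t *\<^sub>R axis i 1)) (nhds 0)"
    by eventually_elim (rule assms(3))
  then show ?thesis unfolding partial_deriv_def by (rule deriv_cong_ev) simp
qed

section \<open>Uniqueness for homogeneous linear differential systems\<close>

text \<open>The zero set of \<open>F\<close> is closed in \<open>S\<close> by continuity, and a
  contraction estimate on small balls, in place of Gronwall's inequality, shows that it is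
  open.\<close>

lemma linear_growth_zero_on_connected:
  fixes F :: "'a::euclidean_space \<Rightarrow> 'b::real_normed_vector"
  assumes S: "open S" "connected S"
    and der: "\<And>x. x \<in> S \<Longrightarrow> (F has_derivative F' x) (at x)"
    and bound: "\<And>x h. x \<in> S \<Longrightarrow> norm (F' x h) \<le> K x * norm (F x) * norm h"
    and K: "continuous_on S K"
    and a: "a \<in> S" "F a = 0" and x: "x \<in> S"
  shows "F x = 0"
proof -
  have contF: "continuous_on S F"
    using der by (meson continuous_at_imp_continuous_on has_derivative_continuous)
  have loc: "\<exists>e>0. ball y e \<subseteq> {x\<in>S. F x = 0}" if y: "y \<in> S" "F y = 0" for y
  proof -
    obtain r0 where r0: "r0 > 0" "cball y r0 \<subseteq> S" using S(1) y open_contains_cball by blast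
    have "compact (K ` cball y r0)"
      by (rule compact_continuous_image) (use continuous_on_subset[OF K r0(2)] in auto)
    then obtain M where "M > 0" "\<forall>v \<in> K ` cball y r0. norm v \<le> M"
      using bounded_pos[of "K ` cball y r0"] compact_imp_bounded by blast
    then have M: "M > 0" "\<And>z. z \<in> cball y r0 \<Longrightarrow> \<bar>K z\<bar> \<le> M"
      by auto
    \<comment> \<open>With \<open>M * r \<le> 1/2\<close> the mean value inequality between the
      centre, where \<open>F\<close> vanishes, and a point \<open>w\<close> of maximal norm gives
      \<open>norm (F w) \<le> norm (F w) / 2\<close>.\<close>
    define r where "r = min r0 (1 / (2*M))"
    have r': "r > 0" "r \<le> r0" "r \<le> 1 / (2*M)"
      using r0 M(1) by (auto simp: r_def)
    have r: "r > 0" "cball y r \<subseteq> cball y r0" "M * r \<le> 1/2"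
      using r' mult_left_mono[OF r'(3), of M] M(1) by auto
    have "continuous_on (cball y r) (\<lambda>z. norm (F z))"
      using continuous_on_subset[OF contF] r(2) r0(2) by (intro continuous_intros) blast
    then obtain w where w: "w \<in> cball y r" "\<And>z. z \<in> cball y r \<Longrightarrow> norm (F z) \<le> norm (F w)"
      using continuous_attains_sup[of "cball y r" "\<lambda>z. norm (F z)"] r(1)
      by (metis cball_eq_empty compact_cball not_less_iff_gr_or_eq)
    have "norm (F w - F y) \<le> (M * norm (F w)) * norm (w - y)"
    proof (rule differentiable_bound[of "cball y r" F F'])
      show "(F has_derivative F' z) (at z within cball y r)" if "z \<in> cball y r" for z
        using der that r r0 by (meson has_derivative_at_withinI subsetD)
      show "onorm (F' z) \<le> M * norm (F w)" if "z \<in> cball y r" for z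
      proof (rule onorm_le)
        fix h
        have z: "z \<in> S" "z \<in> cball y r0" using that r r0 by auto
        have "norm (F' z h) \<le> K z * norm (F z) * norm h" using bound z by blast
        also have "K z * norm (F z) \<le> M * norm (F w)"
          using M(2)[OF z(2)] w(2)[OF that] M(1) by (intro mult_mono) auto
        finally show "norm (F' z h) \<le> M * norm (F w) * norm h" by (simp add: mult_right_mono)
      qed
    qed (use w r in auto)
    also have "\<dots> \<le> M * norm (F w) * r"
      using w(1) M(1) by (intro mult_left_mono) (auto simp: dist_norm norm_minus_commute)
    also have "\<dots> = (M * r) * norm (F w)" by simp
    also have "\<dots> \<le> (1/2) * norm (F w)" using r(3) by (intro mult_right_mono) auto
    finally have "norm (F w) = 0" using y by simp
    then have "\<And>z. z \<in> ball y r \<Longrightarrow> F z = 0" using w(2) by fastforce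
    then show ?thesis using r r0 by (intro exI[of _ r]) force
  qed
  have "open {x\<in>S. F x = 0}" unfolding open_contains_ball using loc by auto
  then have "openin (top_of_set S) {x\<in>S. F x = 0}"
    by (metis (no_types, lifting) S(1) mem_Collect_eq open_openin_trans subsetI)
  moreover have "closedin (top_of_set S) {x\<in>S. F x = 0}"
    using continuous_closedin_preimage_constant[OF contF] by blast
  ultimately have "{x\<in>S. F x = 0} = {} \<or> {x\<in>S. F x = 0} = S" using S(2) connected_clopen by blast
  then show ?thesis using a x by blast
qed

section \<open>Symmetry of second partial derivatives\<close>

lemma has_real_derivative_along_axis:
  fixes F :: "real^'n::finite \<Rightarrow> real"
  assumes "F differentiable (at (y + s *\<^sub>R axis i 1))"
  shows "((\<lambda>t. F (y + t *\<^sub>R axis i 1)) has_real_derivative partial_deriv i F (y + s *\<^sub>R axis i 1)) (at s)"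
proof -
  obtain D where D: "(F has_derivative D) (at (y + s *\<^sub>R axis i 1))"
    using assms differentiable_def by blast
  have "((\<lambda>t. F (y + t *\<^sub>R axis i 1)) has_derivative (\<lambda>t. D (t *\<^sub>R axis i 1))) (at s)"
    by (rule derivative_eq_intros has_derivative_compose[where f="\<lambda>t. y + t *\<^sub>R axis i 1" and g=F] | simp add: D)+
  moreover have "D (t *\<^sub>R axis i 1) = partial_deriv i F (y + s *\<^sub>R axis i 1) * t" for t
    using has_partial_deriv[OF D, of i] linear_scale[OF has_derivative_linear[OF D]] by simp
  ultimately show ?thesis by (simp add: has_field_derivative_def)
qed

text \<open>The mean value theorem is applied twice: along \<open>i\<close> to the difference
  \<open>u\<close> of two parallel edges of the square, then along \<open>j\<close> to the resulting
  difference of values of \<open>partial_deriv i F\<close>.\<close>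

lemma mixed_difference_mean_value:
  fixes F :: "real^'n::finite \<Rightarrow> real"
  assumes t: "t > 0"
    and sub: "\<And>s r. s \<in> {0..t} \<Longrightarrow> r \<in> {0..t} \<Longrightarrow> x + s *\<^sub>R axis i 1 + r *\<^sub>R axis j 1 \<in> S"
    and F: "\<And>y. y \<in> S \<Longrightarrow> F differentiable (at y)"
    and Fi: "\<And>y. y \<in> S \<Longrightarrow> partial_deriv i F differentiable (at y)"
  shows "\<exists>s\<in>{0..t}. \<exists>r\<in>{0..t}.
    F (x + t *\<^sub>R axis i 1 + t *\<^sub>R axis j 1) - F (x + t *\<^sub>R axis i 1) - F (x + t *\<^sub>R axis j 1) + F x
    = t\<^sup>2 * partial_deriv j (partial_deriv i F) (x + s *\<^sub>R axis i 1 + r *\<^sub>R axis j 1)"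
proof -
  let ?e = "axis i 1 :: real^'n" and ?d = "axis j 1 :: real^'n"
  define u where "u = (\<lambda>s. F (x + s *\<^sub>R ?e + t *\<^sub>R ?d) - F (x + s *\<^sub>R ?e))"
  have der: "(u has_real_derivative (partial_deriv i F (x + s *\<^sub>R ?e + t *\<^sub>R ?d) - partial_deriv i F (x + s *\<^sub>R ?e))) (at s)"
    if "0 \<le> s" "s \<le> t" for s
  proof -
    have 1: "x + s *\<^sub>R ?e + t *\<^sub>R ?d \<in> S" "x + s *\<^sub>R ?e \<in> S"
      using sub[of s t] sub[of s 0] that t by auto
    have "((\<lambda>s. F (x + t *\<^sub>R ?d + s *\<^sub>R ?e)) has_real_derivative partial_deriv i F (x + t *\<^sub>R ?d + s *\<^sub>R ?e)) (at s)"
      by (rule has_real_derivative_along_axis) (use F[OF 1(1)] in \<open>simp add: ac_simps\<close>)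
    moreover have "((\<lambda>s. F (x + s *\<^sub>R ?e)) has_real_derivative partial_deriv i F (x + s *\<^sub>R ?e)) (at s)"
      by (rule has_real_derivative_along_axis) (use F[OF 1(2)] in simp)
    ultimately show ?thesis unfolding u_def
      by (auto intro!: derivative_eq_intros simp: add.commute add.left_commute)
  qed
  obtain s where s: "0 < s" "s < t" "u t - u 0 = (t - 0) * (partial_deriv i F (x + s *\<^sub>R ?e + t *\<^sub>R ?d) - partial_deriv i F (x + s *\<^sub>R ?e))"
    using MVT2[OF t der] by blast
  have "((\<lambda>r. partial_deriv i F (x + s *\<^sub>R ?e + r *\<^sub>R ?d)) has_real_derivative
      partial_deriv j (partial_deriv i F) (x + s *\<^sub>R ?e + r *\<^sub>R ?d)) (at r)" if "0 \<le> r" "r \<le> t" for r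
    by (rule has_real_derivative_along_axis) (use Fi[OF sub[of s r]] s that in simp)
  then obtain r where r: "0 < r" "r < t" "partial_deriv i F (x + s *\<^sub>R ?e + t *\<^sub>R ?d) - partial_deriv i F (x + s *\<^sub>R ?e + 0 *\<^sub>R ?d)
     = (t - 0) * partial_deriv j (partial_deriv i F) (x + s *\<^sub>R ?e + r *\<^sub>R ?d)"
    using MVT2[OF t, of "\<lambda>r. partial_deriv i F (x + s *\<^sub>R ?e + r *\<^sub>R ?d)"
        "\<lambda>r. partial_deriv j (partial_deriv i F) (x + s *\<^sub>R ?e + r *\<^sub>R ?d)"] by blast
  show ?thesis
  proof (intro bexI)
    show "F (x + t *\<^sub>R ?e + t *\<^sub>R ?d) - F (x + t *\<^sub>R ?e) - F (x + t *\<^sub>R ?d) + F x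
      = t\<^sup>2 * partial_deriv j (partial_deriv i F) (x + s *\<^sub>R ?e + r *\<^sub>R ?d)"
      using s(3) r(3) by (simp add: u_def power2_eq_square)
  qed (use s r in auto)
qed

text \<open>The mixed difference over a small square is symmetric in the two directions. Evaluating
  it in both orders yields values of the two mixed derivatives at points near \<open>x\<close> that
  coincide, and continuity does the rest.\<close>

lemma partial_deriv_commute:
  fixes F :: "real^'n::finite \<Rightarrow> real"
  assumes S: "open S" "x \<in> S" and C2: "Ck_on (Suc (Suc 0)) F S"
  shows "partial_deriv i (partial_deriv j F) x = partial_deriv j (partial_deriv i F) x"
proof (rule ccontr)
  let ?e = "axis i 1 :: real^'n" and ?d = "axis j 1 :: real^'n"
  let ?A = "partial_deriv i (partial_deriv j F)" and ?B = "partial_deriv j (partial_deriv i F)"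
  assume neq: "?A x \<noteq> ?B x"
  have F: "\<And>y. y \<in> S \<Longrightarrow> F differentiable (at y)"
    and Fk: "\<And>k y. y \<in> S \<Longrightarrow> partial_deriv k F differentiable (at y)"
    using C2 S(1) by (auto simp: differentiable_on_eq_differentiable_at)
  have cont: "isCont ?A x" "isCont ?B x"
    using C2 S by (auto simp: continuous_on_eq_continuous_at)
  define eps where "eps = \<bar>?A x - ?B x\<bar> / 2"
  have eps: "eps > 0" using neq by (simp add: eps_def)
  obtain d1 where d1: "d1 > 0" "\<And>y. dist y x < d1 \<Longrightarrow> dist (?A y) (?A x) < eps"
    using cont(1) eps unfolding continuous_at_eps_delta by blast
  obtain d2 where d2: "d2 > 0" "\<And>y. dist y x < d2 \<Longrightarrow> dist (?B y) (?B x) < eps"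
    using cont(2) eps unfolding continuous_at_eps_delta by blast
  obtain d3 where d3: "d3 > 0" "ball x d3 \<subseteq> S" using S open_contains_ball by blast
  \<comment> \<open>All points of the square with side \<open>t\<close> at \<open>x\<close> are
    within \<open>2 * t\<close> of \<open>x\<close>, so a third of the smallest radius
    suffices.\<close>
  define t where "t = min d1 (min d2 d3) / 3"
  have t: "t > 0" "2 * t < d1" "2 * t < d2" "2 * t < d3"
    using d1(1) d2(1) d3(1) by (auto simp: t_def min_def)
  have close: "dist (x + s *\<^sub>R axis k 1 + r *\<^sub>R axis l 1) x \<le> 2 * t" if "s \<in> {0..t}" "r \<in> {0..t}"
    for s r and k l :: 'n
  proof -
    have "dist (x + s *\<^sub>R axis k 1 + r *\<^sub>R axis l 1) x = norm (s *\<^sub>R axis k (1::real) + r *\<^sub>R axis l (1::real))"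
      by (simp add: dist_norm add.assoc)
    also have "\<dots> \<le> norm (s *\<^sub>R axis k (1::real)) + norm (r *\<^sub>R axis l (1::real))"
      by (rule norm_triangle_ineq)
    finally show ?thesis using that by simp
  qed
  have inS: "x + s *\<^sub>R axis k 1 + r *\<^sub>R axis l 1 \<in> S" if "s \<in> {0..t}" "r \<in> {0..t}" for s r k l
    using close[OF that, of k l] t(4) d3(2) by (auto simp: dist_commute)
  obtain s r where 1: "s \<in> {0..t}" "r \<in> {0..t}"
    "F (x + t *\<^sub>R ?e + t *\<^sub>R ?d) - F (x + t *\<^sub>R ?e) - F (x + t *\<^sub>R ?d) + F x = t\<^sup>2 * ?B (x + s *\<^sub>R ?e + r *\<^sub>R ?d)"
    using mixed_difference_mean_value[of t x i j S F, OF t(1) inS F Fk] by blast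
  obtain s' r' where 2: "s' \<in> {0..t}" "r' \<in> {0..t}"
    "F (x + t *\<^sub>R ?d + t *\<^sub>R ?e) - F (x + t *\<^sub>R ?d) - F (x + t *\<^sub>R ?e) + F x = t\<^sup>2 * ?A (x + s' *\<^sub>R ?d + r' *\<^sub>R ?e)"
    using mixed_difference_mean_value[of t x j i S F, OF t(1) inS F Fk] by blast
  have "t\<^sup>2 * ?B (x + s *\<^sub>R ?e + r *\<^sub>R ?d) = t\<^sup>2 * ?A (x + s' *\<^sub>R ?d + r' *\<^sub>R ?e)"
    using 1(3) 2(3) by (simp add: algebra_simps)
  then have "?B (x + s *\<^sub>R ?e + r *\<^sub>R ?d) = ?A (x + s' *\<^sub>R ?d + r' *\<^sub>R ?e)"
    using t(1) by simp
  moreover have "dist (?B (x + s *\<^sub>R ?e + r *\<^sub>R ?d)) (?B x) < eps"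
    using close[OF 1(1,2), of i j] t(3) by (intro d2(2)) linarith
  moreover have "dist (?A (x + s' *\<^sub>R ?d + r' *\<^sub>R ?e)) (?A x) < eps"
    using close[OF 2(1,2), of j i] t(2) by (intro d1(2)) linarith
  ultimately have "\<bar>?A x - ?B x\<bar> < 2 * eps" unfolding dist_real_def by linarith
  then show False by (simp add: eps_def)
qed

section \<open>Differentiability of the inverse matrix\<close>

lemma invertible_matrix_inv:
  fixes A :: "real^'n::finite^'n"
  assumes "invertible A"
  shows "A ** matrix_inv A = mat 1" "matrix_inv A ** A = mat 1"
proof -
  have "A ** matrix_inv A = mat 1 \<and> matrix_inv A ** A = mat 1"
    using assms unfolding matrix_inv_def invertible_def by (rule someI_ex)
  then show "A ** matrix_inv A = mat 1" "matrix_inv A ** A = mat 1" by auto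
qed

text \<open>This is Cramer's rule for the \<open>l\<close>th basis vector as right-hand side. It
  exhibits the entries of the inverse as quotients of determinants, which makes them
  differentiable.\<close>

lemma matrix_inv_entry:
  fixes A :: "real^'n::finite^'n"
  assumes "invertible A"
  shows "matrix_inv A $ k $ l = det (\<chi> i j. if j = k then axis l 1 $ i else A $ i $ j) / det A"
proof -
  have "A *v (matrix_inv A *v axis l 1) = axis l 1"
    using invertible_matrix_inv[OF assms] by (simp add: matrix_vector_mul_assoc)
  then have "matrix_inv A *v axis l 1 = (\<chi> k. det (\<chi> i j. if j = k then axis l 1 $ i else A $ i $ j) / det A)"
    using cramer[of A] assms invertible_det_nz by blast
  moreover have "(matrix_inv A *v axis l 1) $ k = matrix_inv A $ k $ l"
    by (simp add: matrix_vector_mult_basis column_def)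
  ultimately show ?thesis by simp
qed

lemma differentiable_det:
  fixes A :: "'a::real_normed_vector \<Rightarrow> real^'n::finite^'n"
  assumes "\<And>i j. (\<lambda>x. A x $ i $ j) differentiable (at x)"
  shows "(\<lambda>x. det (A x)) differentiable (at x)"
proof -
  have "(\<lambda>x. \<Prod>i\<in>I. A x $ i $ p i) differentiable (at x)" if "finite I" for I p
    using that by (induction I) (auto intro: differentiable_mult assms)
  then show ?thesis unfolding det_def by (intro differentiable_sum differentiable_mult differentiable_const) (auto simp: finite_permutations)
qed

lemma differentiable_matrix_inv:
  fixes A :: "'a::real_normed_vector \<Rightarrow> real^'n::finite^'n"
  assumes "open S" "x \<in> S" "\<And>y. y \<in> S \<Longrightarrow> invertible (A y)"
    and "\<And>i j. (\<lambda>x. A x $ i $ j) differentiable (at x)"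
  shows "(\<lambda>x. matrix_inv (A x) $ k $ l) differentiable (at x)"
proof -
  have "(\<lambda>x. det (\<chi> i j. if j = k then axis l 1 $ i else A x $ i $ j)) differentiable (at x)"
  proof (rule differentiable_det)
    show "(\<lambda>x. (\<chi> i j. if j = k then axis l 1 $ i else A x $ i $ j) $ i $ j) differentiable (at x)" for i j
      using assms(4) by (cases "j = k") auto
  qed
  then have "(\<lambda>x. det (\<chi> i j. if j = k then axis l 1 $ i else A x $ i $ j) / det (A x)) differentiable (at x)"
    using differentiable_det[of A x, OF assms(4)] assms(2,3) invertible_det_nz[of "A x"]
    by (intro differentiable_divide) auto
  then obtain D where "((\<lambda>x. det (\<chi> i j. if j = k then axis l 1 $ i else A x $ i $ j) / det (A x)) has_derivative D) (at x)"
    unfolding differentiable_def by blast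
  then have "((\<lambda>x. matrix_inv (A x) $ k $ l) has_derivative D) (at x)"
    by (rule has_derivative_transform_within_open[OF _ assms(1,2)]) (simp add: matrix_inv_entry assms(3))
  then show ?thesis unfolding differentiable_def by blast
qed

subsection \<open>Commutative algebras with an invariant inner product\<close>

text \<open>No unit is assumed: the product vanishes identically when the third derivatives of
  \<open>f\<close> vanish at the base point.\<close>

locale euclidean_frobenius_algebra =
  fixes G :: "'a::euclidean_space \<Rightarrow> 'a \<Rightarrow> real" and mul :: "'a \<Rightarrow> 'a \<Rightarrow> 'a"
  assumes bilinear_G: "bilinear G" and G_sym: "G x y = G y x" and G_pos: "x \<noteq> 0 \<Longrightarrow> G x x > 0"
    and bilinear_mul: "bilinear mul" and mul_comm: "mul x y = mul y x"
    and mul_assoc: "mul (mul x y) z = mul x (mul y z)"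
    and invariant: "G (mul x y) z = G y (mul x z)"
begin

lemmas G_simps = bilinear_ladd[OF bilinear_G] bilinear_radd[OF bilinear_G]
  bilinear_lmul[OF bilinear_G] bilinear_rmul[OF bilinear_G]
  bilinear_lsub[OF bilinear_G] bilinear_rsub[OF bilinear_G]
  bilinear_lzero[OF bilinear_G] bilinear_rzero[OF bilinear_G]

lemmas mul_simps = bilinear_ladd[OF bilinear_mul] bilinear_radd[OF bilinear_mul]
  bilinear_lmul[OF bilinear_mul] bilinear_rmul[OF bilinear_mul]
  bilinear_lsub[OF bilinear_mul] bilinear_rsub[OF bilinear_mul]
  bilinear_lzero[OF bilinear_mul] bilinear_rzero[OF bilinear_mul]

lemma G_eq_0_iff: "G x x = 0 \<longleftrightarrow> x = 0"
  by (metis G_pos G_simps(7) less_irrefl)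

lemma continuous_on_G [continuous_intros]:
  "continuous_on A f \<Longrightarrow> continuous_on A g \<Longrightarrow> continuous_on A (\<lambda>x. G (f x) (g x))"
  using bilinear_G bilinear_conv_bounded_bilinear bounded_bilinear.continuous_on by blast

lemma continuous_on_mul [continuous_intros]:
  "continuous_on A f \<Longrightarrow> continuous_on A g \<Longrightarrow> continuous_on A (\<lambda>x. mul (f x) (g x))"
  using bilinear_mul bilinear_conv_bounded_bilinear bounded_bilinear.continuous_on by blast

text \<open>The constant is the minimum of \<open>G x x\<close> on the Euclidean unit sphere, and
  homogeneity extends the bound to all \<open>x\<close>. It makes the unit sphere of
  \<open>G\<close> bounded.\<close>

lemma G_coercive: "\<exists>c>0. \<forall>x. c * (norm x)\<^sup>2 \<le> G x x"
proof -
  obtain b :: 'a where "b \<in> Basis" using nonempty_Basis by blast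
  then have ne: "sphere (0::'a) 1 \<noteq> {}" by auto
  have "continuous_on (sphere 0 1) (\<lambda>x. G x x)" by (intro continuous_intros)
  then obtain y :: 'a where y: "y \<in> sphere 0 1" "\<And>z. z \<in> sphere 0 1 \<Longrightarrow> G y y \<le> G z z"
    using continuous_attains_inf[OF compact_sphere ne] by blast
  have "G y y > 0" using y(1) by (intro G_pos) auto
  moreover have "G y y * (norm x)\<^sup>2 \<le> G x x" for x
  proof (cases "x = 0")
    case False
    have "G y y \<le> G ((1 / norm x) *\<^sub>R x) ((1 / norm x) *\<^sub>R x)"
      by (rule y(2)) (use False in auto)
    then show ?thesis using False by (simp add: G_simps field_simps power2_eq_square)
  qed (simp add: G_simps)
  ultimately show ?thesis by blast
qed

lemma compact_G_sphere:
  assumes "subspace S" shows "compact {x\<in>S. G x x = 1}"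
proof -
  obtain c where c: "c > 0" "\<And>x. c * (norm x)\<^sup>2 \<le> G x x" using G_coercive by blast
  have "norm x \<le> sqrt (1 / c)" if "G x x = 1" for x
    using c(2)[of x] c(1) that by (intro real_le_rsqrt) (simp add: field_simps)
  then have "bounded {x\<in>S. G x x = 1}" by (auto intro!: boundedI)
  moreover have "closed (S \<inter> {x. G x x = 1})"
    by (intro closed_Int closed_subspace assms closed_Collect_eq continuous_intros)
  moreover have "S \<inter> {x. G x x = 1} = {x\<in>S. G x x = 1}" by auto
  ultimately show ?thesis by (metis compact_eq_bounded_closed)
qed

text \<open>Commutativity and invariance make \<open>G (mul x y) z\<close> totally symmetric, so the
  cubic expands as in the binomial theorem.\<close>

lemma cubic_expansion:
  "G (mul (\<alpha> *\<^sub>R u + \<beta> *\<^sub>R w) (\<alpha> *\<^sub>R u + \<beta> *\<^sub>R w)) (\<alpha> *\<^sub>R u + \<beta> *\<^sub>R w) =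
   \<alpha>^3 * G (mul u u) u + 3 * \<alpha>\<^sup>2 * \<beta> * G (mul u u) w + 3 * \<alpha> * \<beta>\<^sup>2 * G (mul u w) w + \<beta>^3 * G (mul w w) w"
proof -
  have 1: "G (mul u w) u = G (mul u u) w" by (metis G_sym invariant)
  have 2: "G (mul w w) u = G (mul u w) w" by (metis G_sym invariant mul_comm)
  show ?thesis
    by (simp add: mul_simps G_simps mul_comm[of w u] 1 2 algebra_simps power2_eq_square power3_eq_cube)
qed

lemma normalize_in:
  assumes "subspace S" "x \<in> S" "x \<noteq> 0"
  obtains k where "k > 0" "k *\<^sub>R x \<in> S" "G (k *\<^sub>R x) (k *\<^sub>R x) = 1"
proof
  show "1 / sqrt (G x x) > 0" using G_pos[OF assms(3)] by simp
  show "(1 / sqrt (G x x)) *\<^sub>R x \<in> S" using assms subspace_scale by blast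
  show "G ((1 / sqrt (G x x)) *\<^sub>R x) ((1 / sqrt (G x x)) *\<^sub>R x) = 1"
    using G_pos[OF assms(3)] by (simp add: G_simps)
qed

text \<open>
  The vector is a maximiser \<open>u\<close> of the cubic form \<open>G (x x) x\<close> on the unit sphere. Then \<open>u u = m u\<close>, hence
  multiplication by \<open>u\<close> has eigenvalues \<open>0\<close> and \<open>m\<close>; a unit eigenvector \<open>w\<close> for \<open>m > 0\<close> orthogonal to \<open>u\<close>
  is excluded by the larger value of the form at \<open>(4 u + 3 w) / 5\<close> or \<open>(4 u - 3 w) / 5\<close>.
\<close>

lemma exists_splitting_vector:
  assumes S: "subspace S" "S \<noteq> {0}" and closed: "\<And>x y. x \<in> S \<Longrightarrow> y \<in> S \<Longrightarrow> mul x y \<in> S"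
  shows "\<exists>u\<in>S. G u u = 1 \<and> (\<forall>w\<in>S. G u w = 0 \<longrightarrow> mul u w = 0)"
proof -
  let ?t = "\<lambda>x. G (mul x x) x"
  obtain x0 where x0: "x0 \<in> S" "x0 \<noteq> 0" using S subspace_0 by blast
  have ne: "{x\<in>S. G x x = 1} \<noteq> {}" by (rule normalize_in[OF S(1) x0]) blast
  have "continuous_on {x\<in>S. G x x = 1} ?t" by (intro continuous_intros)
  then obtain u where u: "u \<in> S" "G u u = 1" and max: "\<And>x. x \<in> S \<Longrightarrow> G x x = 1 \<Longrightarrow> ?t x \<le> ?t u"
    using continuous_attains_sup[OF compact_G_sphere[OF S(1)] ne] by blast
  define m where "m = ?t u"
  have max2: "\<alpha>^3 * m + 3 * \<alpha>\<^sup>2 * \<beta> * G (mul u u) w + 3 * \<alpha> * \<beta>\<^sup>2 * G (mul u w) w + \<beta>^3 * ?t w \<le> m"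
    if "w \<in> S" "G w w = 1" "G u w = 0" "\<alpha>\<^sup>2 + \<beta>\<^sup>2 = 1" for \<alpha> \<beta> w
  proof -
    have "G (\<alpha> *\<^sub>R u + \<beta> *\<^sub>R w) (\<alpha> *\<^sub>R u + \<beta> *\<^sub>R w) = 1"
      using that u(2) by (simp add: G_simps G_sym[of w u] power2_eq_square)
    moreover have "\<alpha> *\<^sub>R u + \<beta> *\<^sub>R w \<in> S"
      using that u(1) S(1) by (simp add: subspace_add subspace_scale)
    ultimately show ?thesis using max cubic_expansion unfolding m_def by metis
  qed
  \<comment> \<open>Along the great circle from \<open>u\<close> towards \<open>w\<close> the cubic
    form has a maximum at \<open>u\<close>, where its derivative is
    \<open>3 * G (mul u u) w\<close>.\<close>
  have first_order: "G (mul u u) w = 0" if w: "w \<in> S" "G w w = 1" "G u w = 0" for w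
  proof -
    let ?\<phi> = "\<lambda>s. (cos s)^3 * m + 3 * (cos s)\<^sup>2 * sin s * G (mul u u) w
      + 3 * cos s * (sin s)\<^sup>2 * G (mul u w) w + (sin s)^3 * ?t w"
    have "(?\<phi> has_real_derivative 3 * G (mul u u) w) (at 0)"
      by (rule derivative_eq_intros refl | simp)+
    moreover have "?\<phi> s \<le> ?\<phi> 0" for s
      using max2[OF w, of "cos s" "sin s"] by simp
    ultimately have "3 * G (mul u u) w = 0"
      by (intro DERIV_local_max[where f = ?\<phi> and d = 1 and x = 0]) auto
    then show ?thesis by simp
  qed
  have square: "mul u u = m *\<^sub>R u"
  proof (rule ccontr)
    \<comment> \<open>This is the component of \<open>mul u u\<close> orthogonal to
      \<open>u\<close>; by \<open>first_order\<close> it is orthogonal to \<open>mul u u\<close> as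
      well, hence to itself.\<close>
    define p where "p = mul u u - m *\<^sub>R u"
    assume "mul u u \<noteq> m *\<^sub>R u"
    then have p: "p \<noteq> 0" "p \<in> S"
      using closed u S(1) by (auto simp: p_def intro!: subspace_diff subspace_scale)
    have up: "G u p = 0" using u(2) by (simp add: p_def G_simps m_def G_sym[of u "mul u u"])
    obtain k where k: "k > 0" "k *\<^sub>R p \<in> S" "G (k *\<^sub>R p) (k *\<^sub>R p) = 1"
      using normalize_in[OF S(1) p(2,1)] .
    have "G (mul u u) (k *\<^sub>R p) = 0" by (rule first_order) (use k up in \<open>auto simp: G_simps\<close>)
    moreover have "G (mul u u - m *\<^sub>R u) p = G (mul u u) p"
      using up by (simp add: G_simps)
    then have "G (mul u u) p = G p p" by (simp add: p_def[symmetric])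
    ultimately show False using k(1) p(1) by (simp add: G_simps G_eq_0_iff)
  qed
  have "mul u w = 0" if w: "w \<in> S" "G u w = 0" for w
  proof (rule ccontr)
    define v where "v = mul u w"
    assume "mul u w \<noteq> 0"
    then have v: "v \<noteq> 0" "v \<in> S" using closed u w by (auto simp: v_def)
    have uv: "G u v = 0" using w(2) by (simp add: v_def invariant[symmetric] square G_simps)
    have Lv: "mul u v = m *\<^sub>R v" by (simp add: v_def mul_assoc[symmetric] square mul_simps)
    \<comment> \<open>By invariance \<open>G v v = G w (mul u v) = m * G w v\<close>. The sign of
      \<open>m\<close> then follows by comparing \<open>u\<close> with \<open>- u\<close>, which is
      also a unit vector of \<open>S\<close>.\<close>
    have "m = 0 \<Longrightarrow> G v v = 0" using Lv by (metis G_simps(8) invariant scaleR_zero_left v_def)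
    then have "m \<noteq> 0" using v(1) G_eq_0_iff by blast
    moreover have "?t (- u) \<le> m" unfolding m_def
      by (rule max) (use u S(1) in \<open>auto simp: subspace_neg bilinear_lneg[OF bilinear_G] bilinear_rneg[OF bilinear_G]\<close>)
    then have "- m \<le> m"
      by (simp add: m_def bilinear_lneg[OF bilinear_G] bilinear_rneg[OF bilinear_G]
          bilinear_lneg[OF bilinear_mul] bilinear_rneg[OF bilinear_mul])
    ultimately have m: "m > 0" by simp
    obtain k where k: "k > 0" "k *\<^sub>R v \<in> S" "G (k *\<^sub>R v) (k *\<^sub>R v) = 1"
      using normalize_in[OF S(1) v(2,1)] .
    define z where "z = k *\<^sub>R v"
    have z: "z \<in> S" "G z z = 1" "G u z = 0" and Lz: "mul u z = m *\<^sub>R z"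
      using k uv Lv by (auto simp: z_def G_simps mul_simps)
    \<comment> \<open>The term with \<open>G (mul u u) z\<close> vanishes by
      \<open>first_order\<close>, and the better of the two signs produces the absolute value. The
      coefficients of \<open>m\<close> add up to 172/125, which exceeds 1.\<close>
    have "(4/5)^3 * m + 3 * (4/5) * (3/5)\<^sup>2 * m + (3/5)^3 * \<bar>?t z\<bar> \<le> m"
      using max2[OF z, of "4/5" "3/5"] max2[OF z, of "4/5" "-3/5"] first_order[OF z] z(2)
      by (auto simp: Lz G_simps power2_eq_square power3_eq_cube abs_if)
    moreover have "(3/5)^3 * \<bar>?t z\<bar> \<ge> 0" by simp
    ultimately have "(4/5)^3 * m + 3 * (4/5) * (3/5)\<^sup>2 * m \<le> m" by linarith
    then show False using m by (simp add: power2_eq_square power3_eq_cube)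
  qed
  then show ?thesis using u by blast
qed

text \<open>Induction on the dimension: split off \<open>u\<close> and continue in its orthogonal
  complement inside \<open>S\<close>. The statement is about subspaces closed under
  \<open>mul\<close> so that the complement qualifies again.\<close>

theorem exists_orthonormal_splitting:
  assumes "subspace S" and "\<And>x y. x \<in> S \<Longrightarrow> y \<in> S \<Longrightarrow> mul x y \<in> S"
  shows "\<exists>B. finite B \<and> B \<subseteq> S \<and> span B = S \<and> (\<forall>a\<in>B. \<forall>b\<in>B. G a b = (if a = b then 1 else 0)) \<and>
    (\<forall>a\<in>B. \<forall>b\<in>B. a \<noteq> b \<longrightarrow> mul a b = 0)"
  using assms
proof (induction "dim S" arbitrary: S rule: less_induct)
  case less
  show ?case
  proof (cases "S = {0}")
    case True
    then show ?thesis by (intro exI[of _ "{}"]) auto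
  next
    case False
    obtain u where u: "u \<in> S" "G u u = 1" "\<And>w. w \<in> S \<Longrightarrow> G u w = 0 \<Longrightarrow> mul u w = 0"
      using exists_splitting_vector[OF less.prems(1) False less.prems(2)] by blast
    let ?S = "{w\<in>S. G u w = 0}"
    have sub: "subspace ?S"
      using less.prems(1) by (auto simp: subspace_def G_simps)
    have "u \<notin> ?S" using u(2) by simp
    then have "?S \<subset> S" using u(1) by blast
    then have dim: "dim ?S < dim S"
      using dim_psubset[of ?S S] sub less.prems(1) by (simp add: span_eq_iff[THEN iffD2])
    \<comment> \<open>By invariance \<open>G u (mul x y) = G (mul x u) y\<close>, and
      \<open>mul x u = 0\<close> by the choice of \<open>u\<close>.\<close>
    have cl: "mul x y \<in> ?S" if "x \<in> ?S" "y \<in> ?S" for x y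
    proof -
      have "G u (mul x y) = G (mul x u) y" by (simp add: invariant)
      then show ?thesis using that u(3)[of x] less.prems(2) by (simp add: mul_comm[of x u] G_simps)
    qed
    obtain B where B: "finite B" "B \<subseteq> ?S" "span B = ?S" "\<forall>a\<in>B. \<forall>b\<in>B. G a b = (if a = b then 1 else 0)"
      "\<forall>a\<in>B. \<forall>b\<in>B. a \<noteq> b \<longrightarrow> mul a b = 0"
      using less.hyps[OF dim sub cl] by blast
    have "w \<in> span (insert u B)" if w: "w \<in> S" for w
    proof -
      have "w - G u w *\<^sub>R u \<in> ?S"
        using w u less.prems(1) by (auto simp: G_simps intro!: subspace_diff subspace_scale)
      then show ?thesis using B(3) by (auto simp: span_insert)
    qed
    moreover have "span (insert u B) \<subseteq> S"
      by (rule span_minimal) (use u B less.prems(1) in auto)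
    ultimately have "span (insert u B) = S" by blast
    moreover have "\<forall>b\<in>B. G u b = 0 \<and> G b u = 0 \<and> mul u b = 0 \<and> mul b u = 0"
      using B(2) u(3) by (auto simp: G_sym[of _ u] mul_comm[of _ u])
    ultimately show ?thesis using u B by (intro exI[of _ "insert u B"]) auto
  qed
qed

text \<open>The difference of the two sides is orthogonal to \<open>B\<close>, hence to its span,
  hence to itself.\<close>

lemma orthonormal_expansion:
  assumes "finite B" "span B = UNIV" "\<And>a b. a \<in> B \<Longrightarrow> b \<in> B \<Longrightarrow> G a b = (if a = b then 1 else 0)"
  shows "v = (\<Sum>b\<in>B. G v b *\<^sub>R b)"
proof -
  define w where "w = v - (\<Sum>b\<in>B. G v b *\<^sub>R b)"
  have lin: "linear (\<lambda>x. G x y)" for y by (auto simp: linear_iff G_simps)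
  have "G w b = 0" if "b \<in> B" for b
    by (simp add: w_def G_simps linear_sum[OF lin] assms that if_distrib[where f="\<lambda>t. _ * t"] cong: if_cong)
  moreover have "subspace {x. G w x = 0}" by (auto simp: subspace_def G_simps)
  ultimately have "span B \<subseteq> {x. G w x = 0}" by (intro span_minimal) auto
  then have "G w w = 0" using assms(2) by auto
  then show ?thesis by (simp add: G_eq_0_iff w_def)
qed

lemma card_orthonormal:
  assumes "finite B" "span B = UNIV" "\<And>a b. a \<in> B \<Longrightarrow> b \<in> B \<Longrightarrow> G a b = (if a = b then 1 else 0)"
  shows "card B = DIM('a)"
proof -
  have lin: "linear (\<lambda>x. G x y)" for y by (auto simp: linear_iff G_simps)
  have "u b = 0" if "(\<Sum>v\<in>B. u v *\<^sub>R v) = 0" "b \<in> B" for u b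
  proof -
    have "G (\<Sum>v\<in>B. u v *\<^sub>R v) b = u b"
      by (simp add: linear_sum[OF lin] G_simps assms that(2) if_distrib[where f="\<lambda>t. _ * t"] cong: if_cong)
    then show ?thesis using that by (simp add: G_simps)
  qed
  then have "independent B" using assms(1) by (auto simp: independent_explicit)
  then show ?thesis by (metis assms(2) dim_UNIV dim_eq_card_independent dim_span)
qed

end

subsection \<open>The Calabi metric of a graph\<close>

definition matrix_partial ::
  "'n::finite \<Rightarrow> (real ^ 'n \<Rightarrow> real ^ 'n ^ 'n) \<Rightarrow> real ^ 'n \<Rightarrow> real ^ 'n ^ 'n" where
  "matrix_partial l M x = (\<chi> i j. partial_deriv l (\<lambda>y. M y $ i $ j) x)"

lemma has_derivative_matrix_partial:
  assumes "\<And>i j. (\<lambda>y. M y $ i $ j) differentiable (at x)"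
  shows "(M has_derivative (\<lambda>h. \<Sum>l\<in>UNIV. h $ l *\<^sub>R matrix_partial l M x)) (at x)"
proof (intro has_derivative_vecI)
  show "((\<lambda>y. M y $ i $ j) has_derivative (\<lambda>h. (\<Sum>l\<in>UNIV. h $ l *\<^sub>R matrix_partial l M x) $ i $ j)) (at x)" for i j
    using differentiable_imp_has_partials[OF assms, of i j] by (simp add: matrix_partial_def)
qed

lemma matrix_partial_mult:
  assumes A: "\<And>i j. (\<lambda>y. A y $ i $ j) differentiable (at x)" and B: "\<And>i j. (\<lambda>y. B y $ i $ j) differentiable (at x)"
  shows "matrix_partial l (\<lambda>y. A y ** B y) x = A x ** matrix_partial l B x + matrix_partial l A x ** B x"
proof -
  let ?D = "\<lambda>h. A x ** (\<Sum>l\<in>UNIV. h $ l *\<^sub>R matrix_partial l B x) + (\<Sum>l\<in>UNIV. h $ l *\<^sub>R matrix_partial l A x) ** B x"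
  have D: "((\<lambda>y. A y ** B y) has_derivative ?D) (at x)"
    by (intro has_derivative_matrix_mult has_derivative_matrix_partial assms)
  have "((\<lambda>y. (A y ** B y) $ i $ j) has_derivative (\<lambda>h. ?D h $ i $ j)) (at x)" for i j
    by (intro bounded_linear.has_derivative[OF bounded_linear_vec_nth] D)
  then have "partial_deriv l (\<lambda>y. (A y ** B y) $ i $ j) x = ?D (axis l 1) $ i $ j" for i j
    by (rule has_partial_deriv)
  moreover have "(\<Sum>k\<in>UNIV. axis l (1::real) $ k *\<^sub>R matrix_partial k M x) = matrix_partial l M x" for M
    by (simp add: axis_def if_distrib[where f="\<lambda>t. t *\<^sub>R _"] cong: if_cong)
  ultimately have "partial_deriv l (\<lambda>y. (A y ** B y) $ i $ j) x
      = (A x ** matrix_partial l B x + matrix_partial l A x ** B x) $ i $ j" for i j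
    by simp
  then show ?thesis
    unfolding matrix_partial_def[of l "\<lambda>y. A y ** B y"] vec_eq_iff[of "vec_lambda _"]
    by (simp add: vec_eq_iff)
qed

lemma invertible_positive_definite:
  assumes "positive_definite A" shows "invertible A"
proof -
  have "x = 0" if "A *v x = 0" for x
    using assms that unfolding positive_definite_def by (metis inner_zero_right less_irrefl)
  then show ?thesis using matrix_left_invertible_ker[of A] invertible_left_inverse[of A] by blast
qed

locale calabi_graph =
  fixes f :: "real ^ 'n::finite \<Rightarrow> real" and \<Omega> :: "(real ^ 'n) set"
  assumes open_domain: "open \<Omega>"
    and smooth: "smooth_fun_on f \<Omega>"
    and convex: "strictly_convex_on f \<Omega>"
    and flat: "flat_metric_on (calabi_metric f) \<Omega>"
    and parallel: "parallel3_on (calabi_metric f) (cubic_form f) \<Omega>"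
begin

definition third :: "'n \<Rightarrow> 'n \<Rightarrow> 'n \<Rightarrow> real ^ 'n \<Rightarrow> real" where
  "third i j k = partial_deriv i (partial_deriv j (partial_deriv k f))"

abbreviation g :: "real ^ 'n \<Rightarrow> real ^ 'n ^ 'n" where "g \<equiv> hessian f"

definition C :: "'n \<Rightarrow> real ^ 'n \<Rightarrow> real ^ 'n ^ 'n" where "C i x = (\<chi> j k. third i j k x)"

text \<open>The row index is the upper one, so \<open>\<Gamma> i x *v v\<close> is the covariant
  derivative of the constant field \<open>v\<close> along the \<open>i\<close>th coordinate
  field.\<close>

definition \<Gamma> :: "'n \<Rightarrow> real ^ 'n \<Rightarrow> real ^ 'n ^ 'n" where "\<Gamma> i x = (\<chi> k j. christoffel g k i j x)"

lemma
  shows Ck: "Ck_on m f \<Omega>" "Ck_on m (partial_deriv k f) \<Omega>" "Ck_on m (partial_deriv j (partial_deriv k f)) \<Omega>"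
    "Ck_on m (third i j k) \<Omega>"
  using smooth[unfolded smooth_fun_on_def, rule_format, of m]
    smooth[unfolded smooth_fun_on_def, rule_format, of "Suc m"]
    smooth[unfolded smooth_fun_on_def, rule_format, of "Suc (Suc m)"]
    smooth[unfolded smooth_fun_on_def, rule_format, of "Suc (Suc (Suc m))"]
  by (simp_all add: third_def)

lemma Ck_differentiable: "Ck_on (Suc 0) F \<Omega> \<Longrightarrow> x \<in> \<Omega> \<Longrightarrow> F differentiable (at x)"
  using open_domain by (simp add: differentiable_on_eq_differentiable_at)

lemmas differentiable = Ck_differentiable[OF Ck(1)] Ck_differentiable[OF Ck(2)]
  Ck_differentiable[OF Ck(3)] Ck_differentiable[OF Ck(4)]

lemma g_nth: "g x $ i $ j = partial_deriv i (partial_deriv j f) x"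
  by (simp add: hessian_def)

lemma second_commute: "x \<in> \<Omega> \<Longrightarrow> partial_deriv i (partial_deriv j f) x = partial_deriv j (partial_deriv i f) x"
  by (rule partial_deriv_commute[OF open_domain _ Ck(1)])

lemma third_commute: assumes "x \<in> \<Omega>" shows "third i j k x = third i k j x" "third i j k x = third j i k x"
  using partial_deriv_cong[OF open_domain assms second_commute]
    partial_deriv_commute[OF open_domain assms Ck(2)] by (auto simp: third_def)

lemma g_symmetric: "x \<in> \<Omega> \<Longrightarrow> transpose (g x) = g x"
  using convex by (simp add: strictly_convex_on_def positive_definite_def)

lemma g_invertible: "x \<in> \<Omega> \<Longrightarrow> invertible (g x)"
  using convex by (simp add: strictly_convex_on_def invertible_positive_definite)

lemma g_cancel: "x \<in> \<Omega> \<Longrightarrow> g x ** A = g x ** B \<Longrightarrow> A = B"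
  by (metis g_invertible invertible_matrix_inv(2) matrix_mul_assoc matrix_mul_lid)

lemma C_symmetric: "x \<in> \<Omega> \<Longrightarrow> transpose (C i x) = C i x"
  using third_commute by (auto simp: C_def transpose_def vec_eq_iff)

text \<open>For a Hessian metric all three derivatives of \<open>g\<close> are the same third
  derivative of \<open>f\<close>, and two of them cancel.\<close>

lemma christoffel_eq:
  assumes "x \<in> \<Omega>"
  shows "christoffel g k i j x = 1/2 * (\<Sum>l\<in>UNIV. matrix_inv (g x) $ k $ l * third i l j x)"
proof -
  have "(\<lambda>y. g y $ i $ j) = partial_deriv i (partial_deriv j f)" for i j
    by (simp add: hessian_def)
  then have 1: "partial_deriv i (\<lambda>y. g y $ j $ k) x = third i j k x" for i j k
    by (simp add: third_def)
  have "third i j l x + third j i l x - third l i j x = third i l j x" for l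
    using third_commute[OF assms] by (metis add_diff_cancel_right')
  then show ?thesis by (simp add: christoffel_def 1)
qed

lemma \<Gamma>_eq: "x \<in> \<Omega> \<Longrightarrow> \<Gamma> i x = (1/2) *\<^sub>R (matrix_inv (g x) ** C i x)"
  by (simp add: \<Gamma>_def vec_eq_iff christoffel_eq matrix_matrix_mult_def C_def)

lemma g_\<Gamma>: "x \<in> \<Omega> \<Longrightarrow> g x ** \<Gamma> i x = (1/2) *\<^sub>R C i x"
  by (simp add: \<Gamma>_eq matrix_scaleR matrix_mul_assoc invertible_matrix_inv(1) g_invertible)

text \<open>Together with \<open>g_\<Gamma>\<close> this says that \<open>\<Gamma> i x\<close> is
  self-adjoint for the metric, the source of the invariance of the product.\<close>

lemma \<Gamma>_transpose_g: "x \<in> \<Omega> \<Longrightarrow> transpose (\<Gamma> i x) ** g x = (1/2) *\<^sub>R C i x"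
  using arg_cong[OF g_\<Gamma>, of x transpose i] by (simp add: matrix_transpose_mul g_symmetric C_symmetric transpose_scalar)

lemma \<Gamma>_nth: "\<Gamma> i x $ k $ j = christoffel g k i j x" by (simp add: \<Gamma>_def)

lemma \<Gamma>_commute_lower: assumes "x \<in> \<Omega>" shows "\<Gamma> i x $ k $ j = \<Gamma> j x $ k $ i"
  unfolding \<Gamma>_nth christoffel_eq[OF assms] by (metis third_commute[OF assms])

lemma g_differentiable: "x \<in> \<Omega> \<Longrightarrow> (\<lambda>y. g y $ i $ j) differentiable (at x)"
  by (simp add: hessian_def differentiable)

lemma C_differentiable: "x \<in> \<Omega> \<Longrightarrow> (\<lambda>y. C l y $ i $ j) differentiable (at x)"
  by (simp add: C_def differentiable)

lemma christoffel_differentiable: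
  assumes "x \<in> \<Omega>" shows "christoffel g k i j differentiable (at x)"
proof -
  have "(\<lambda>y. matrix_inv (g y) $ k $ l) differentiable (at x)" for l
    by (rule differentiable_matrix_inv[OF open_domain assms g_invertible g_differentiable[OF assms]])
  then have "(\<lambda>x. 1/2 * (\<Sum>l\<in>UNIV. matrix_inv (g x) $ k $ l * third i l j x)) differentiable (at x)"
    by (intro differentiable_mult differentiable_sum differentiable_const) (auto simp: differentiable assms)
  then obtain D where "((\<lambda>x. 1/2 * (\<Sum>l\<in>UNIV. matrix_inv (g x) $ k $ l * third i l j x)) has_derivative D) (at x)"
    unfolding differentiable_def by blast
  then have "(christoffel g k i j has_derivative D) (at x)"
    by (rule has_derivative_transform_within_open[OF _ open_domain assms]) (simp add: christoffel_eq)
  then show ?thesis unfolding differentiable_def by blast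
qed

lemma \<Gamma>_differentiable: "x \<in> \<Omega> \<Longrightarrow> (\<lambda>y. \<Gamma> l y $ i $ j) differentiable (at x)"
  by (simp add: \<Gamma>_def christoffel_differentiable)

lemma matrix_partial_g: "x \<in> \<Omega> \<Longrightarrow> matrix_partial l g x = C l x"
  by (simp add: matrix_partial_def hessian_def C_def third_def)

text \<open>This is \<open>\<nabla>A = 0\<close> solved for the derivative, with the factor -1/2 of
  the cubic form cancelled. The correction at the index \<open>k\<close> is a multiplication from
  the right, the one at \<open>j\<close> a multiplication by the transpose from the left.\<close>

lemma matrix_partial_C:
  assumes x: "x \<in> \<Omega>"
  shows "matrix_partial l (C i) x =
    (\<Sum>m\<in>UNIV. \<Gamma> l x $ m $ i *\<^sub>R C m x) + C i x ** \<Gamma> l x + transpose (\<Gamma> l x) ** C i x"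
proof -
  have "partial_deriv l (third i j k) x =
     (\<Sum>m\<in>UNIV. \<Gamma> l x $ m $ i * third m j k x + \<Gamma> l x $ m $ j * third i m k x + \<Gamma> l x $ m $ k * third i j m x)" for j k
  proof -
    have "(third i j k has_derivative (\<lambda>h. \<Sum>m\<in>UNIV. h $ m * partial_deriv m (third i j k) x)) (at x)"
      by (rule differentiable_imp_has_partials) (simp add: differentiable x)
    then have "(cubic_form f i j k has_derivative (\<lambda>h. - (1/2) * (\<Sum>m\<in>UNIV. h $ m * partial_deriv m (third i j k) x))) (at x)"
      unfolding cubic_form_def third_def by (rule has_derivative_mult_right)
    then have 1: "partial_deriv l (cubic_form f i j k) x = - (1/2) * partial_deriv l (third i j k) x"
      by (drule_tac has_partial_deriv[where i = l])
        (simp add: axis_def if_distrib[where f="\<lambda>t. t * _"] cong: if_cong)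
    have "covariant_deriv3 g (cubic_form f) l i j k x = 0"
      using parallel x by (simp add: parallel3_on_def calabi_metric_def)
    then have "partial_deriv l (cubic_form f i j k) x = (\<Sum>m\<in>UNIV. \<Gamma> l x $ m $ i * cubic_form f m j k x
        + \<Gamma> l x $ m $ j * cubic_form f i m k x + \<Gamma> l x $ m $ k * cubic_form f i j m x)"
      by (simp add: covariant_deriv3_def \<Gamma>_nth)
    also have "\<dots> = - (1/2) * (\<Sum>m\<in>UNIV. \<Gamma> l x $ m $ i * third m j k x + \<Gamma> l x $ m $ j * third i m k x + \<Gamma> l x $ m $ k * third i j m x)"
      unfolding sum_distrib_left by (intro sum.cong refl) (simp add: cubic_form_def third_def algebra_simps)
    finally show ?thesis unfolding 1 by simp
  qed
  then show ?thesis
    by (simp add: vec_eq_iff matrix_partial_def C_def matrix_matrix_mult_def transpose_def sum.distrib algebra_simps)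
qed

text \<open>Differentiate \<open>g ** \<Gamma> i = (1/2) *\<^sub>R C i\<close>, insert
  \<open>matrix_partial_C\<close>, write every \<open>C\<close> as
  \<open>2 *\<^sub>R (g ** \<Gamma>)\<close> and cancel \<open>g\<close>.\<close>

lemma matrix_partial_\<Gamma>_parallel:
  assumes x: "x \<in> \<Omega>"
  shows "matrix_partial l (\<Gamma> i) x = (\<Sum>m\<in>UNIV. \<Gamma> l x $ m $ i *\<^sub>R \<Gamma> m x) + \<Gamma> i x ** \<Gamma> l x - \<Gamma> l x ** \<Gamma> i x"
proof -
  have "matrix_partial l (\<lambda>y. g y ** \<Gamma> i y) x = matrix_partial l (\<lambda>y. (1/2) *\<^sub>R C i y) x"
    unfolding matrix_partial_def vec_eq_iff
    by (auto intro!: partial_deriv_cong[OF open_domain x] simp: g_\<Gamma>)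
  also have "\<dots> = (1/2) *\<^sub>R matrix_partial l (C i) x"
  proof -
    have "partial_deriv l (\<lambda>y. 1/2 * C i y $ j $ k) x = 1/2 * partial_deriv l (\<lambda>y. C i y $ j $ k) x" for j k
      by (subst has_partial_deriv[OF has_derivative_mult_right[OF differentiable_imp_has_partials[OF C_differentiable[OF x]]]])
        (auto simp: axis_def if_distrib[where f="\<lambda>t. t * _"] cong: if_cong)
    then show ?thesis by (simp add: matrix_partial_def vec_eq_iff)
  qed
  finally have "g x ** matrix_partial l (\<Gamma> i) x + C l x ** \<Gamma> i x = (1/2) *\<^sub>R matrix_partial l (C i) x"
    by (simp add: matrix_partial_mult g_differentiable \<Gamma>_differentiable x matrix_partial_g)
  then have "g x ** matrix_partial l (\<Gamma> i) x = (1/2) *\<^sub>R matrix_partial l (C i) x - C l x ** \<Gamma> i x"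
    by (simp add: eq_diff_eq)
  moreover have C: "C m x = 2 *\<^sub>R (g x ** \<Gamma> m x)" for m by (simp add: g_\<Gamma> x)
  have CG: "C l x ** \<Gamma> i x = 2 *\<^sub>R (g x ** (\<Gamma> l x ** \<Gamma> i x))"
    "C i x ** \<Gamma> l x = 2 *\<^sub>R (g x ** (\<Gamma> i x ** \<Gamma> l x))"
    unfolding C by (simp_all add: matrix_scaleR matrix_mul_assoc)
  moreover have "transpose (\<Gamma> l x) ** C i x = 2 *\<^sub>R ((transpose (\<Gamma> l x) ** g x) ** \<Gamma> i x)"
    unfolding C[of i] by (simp only: matrix_scaleR matrix_mul_assoc)
  then have "transpose (\<Gamma> l x) ** C i x = 2 *\<^sub>R (g x ** (\<Gamma> l x ** \<Gamma> i x))"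
    by (simp add: \<Gamma>_transpose_g[OF x] matrix_scaleR CG(1))
  moreover have "(\<Sum>m\<in>UNIV. \<Gamma> l x $ m $ i *\<^sub>R C m x) = 2 *\<^sub>R (g x ** (\<Sum>m\<in>UNIV. \<Gamma> l x $ m $ i *\<^sub>R \<Gamma> m x))"
    unfolding C by (simp add: matrix_scaleR matrix_sum scaleR_sum_right mult.commute)
  ultimately have "g x ** matrix_partial l (\<Gamma> i) x =
      g x ** (\<Sum>m\<in>UNIV. \<Gamma> l x $ m $ i *\<^sub>R \<Gamma> m x) + g x ** (\<Gamma> i x ** \<Gamma> l x) + g x ** (\<Gamma> l x ** \<Gamma> i x)
      - 2 *\<^sub>R (g x ** (\<Gamma> l x ** \<Gamma> i x))"
    by (simp add: matrix_partial_C[OF x] scaleR_add_right)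
  also have "\<dots> = g x ** ((\<Sum>m\<in>UNIV. \<Gamma> l x $ m $ i *\<^sub>R \<Gamma> m x) + \<Gamma> i x ** \<Gamma> l x - \<Gamma> l x ** \<Gamma> i x)"
    by (simp add: matrix_add_ldistrib matrix_diff scaleR_2)
  finally show ?thesis using g_cancel[OF x] by blast
qed

lemma sum_\<Gamma>_nth:
  assumes x: "x \<in> \<Omega>"
  shows "(\<Sum>m\<in>UNIV. \<Gamma> l x $ m $ i *\<^sub>R \<Gamma> m x) $ k $ j = (\<Gamma> j x ** \<Gamma> l x) $ k $ i"
  unfolding matrix_matrix_mult_def
  by (simp add: \<Gamma>_commute_lower[OF x, of _ k j] mult.commute)

text \<open>In the curvature the sums from \<open>matrix_partial_\<Gamma>_parallel\<close> are
  symmetric in \<open>i\<close>, \<open>j\<close> and cancel. The derivatives leave twice the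
  commutator of \<open>\<Gamma> j\<close> and \<open>\<Gamma> i\<close>, the quadratic terms its
  negative, so one commutator remains.\<close>

lemma \<Gamma>_commute:
  assumes x: "x \<in> \<Omega>"
  shows "\<Gamma> i x ** \<Gamma> j x = \<Gamma> j x ** \<Gamma> i x"
proof -
  have "riemann_curvature g k p i j x = 0" for k p
    using flat x by (simp add: flat_metric_on_def calabi_metric_def)
  then have "matrix_partial i (\<Gamma> j) x - matrix_partial j (\<Gamma> i) x + \<Gamma> i x ** \<Gamma> j x - \<Gamma> j x ** \<Gamma> i x = 0"
    by (simp add: riemann_curvature_def vec_eq_iff matrix_partial_def \<Gamma>_nth matrix_matrix_mult_def sum_subtractf algebra_simps)
  moreover have "(\<Sum>m\<in>UNIV. \<Gamma> i x $ m $ j *\<^sub>R \<Gamma> m x) = (\<Sum>m\<in>UNIV. \<Gamma> j x $ m $ i *\<^sub>R \<Gamma> m x)"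
    by (simp add: \<Gamma>_commute_lower[OF x, of i])
  ultimately have "\<Gamma> j x ** \<Gamma> i x - \<Gamma> i x ** \<Gamma> j x = 0"
    by (simp add: matrix_partial_\<Gamma>_parallel[OF x] algebra_simps)
  then show ?thesis by simp
qed

text \<open>The remaining sum is turned into a matrix product by exchanging lower indices twice,
  with one use of commutativity in between.\<close>

lemma matrix_partial_\<Gamma>:
  assumes x: "x \<in> \<Omega>"
  shows "matrix_partial l (\<Gamma> i) x = \<Gamma> l x ** \<Gamma> i x"
proof -
  have "(\<Sum>m\<in>UNIV. \<Gamma> l x $ m $ i *\<^sub>R \<Gamma> m x) $ k $ j = (\<Gamma> l x ** \<Gamma> i x) $ k $ j" for k j
  proof -
    have "(\<Sum>m\<in>UNIV. \<Gamma> l x $ m $ i *\<^sub>R \<Gamma> m x) $ k $ j = (\<Gamma> l x ** \<Gamma> j x) $ k $ i"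
      using sum_\<Gamma>_nth[OF x] \<Gamma>_commute[OF x, of j l] by metis
    also have "\<dots> = (\<Gamma> l x ** \<Gamma> i x) $ k $ j"
      unfolding matrix_matrix_mult_def by (simp add: \<Gamma>_commute_lower[OF x, of j])
    finally show ?thesis .
  qed
  then have "(\<Sum>m\<in>UNIV. \<Gamma> l x $ m $ i *\<^sub>R \<Gamma> m x) = \<Gamma> l x ** \<Gamma> i x" by (simp add: vec_eq_iff)
  then show ?thesis by (simp add: matrix_partial_\<Gamma>_parallel[OF x] \<Gamma>_commute[OF x, of i])
qed

end

section \<open>Reduction to the model hypersurfaces\<close>

text \<open>The image of the domain under the affine bijection is open, so the graph of
  \<open>F\<close> over it is the model graph cut by an open cylinder. The affine summand of
  \<open>f\<close> is removed by the parameters \<open>- q\<close> and \<open>- c\<close> of the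
  Calabi map.\<close>

lemma equivalent_to_open_part_graph:
  fixes \<Omega> D :: "(real ^ 'n::finite) set" and c :: real
  assumes P: "invertible P" and \<Omega>: "open \<Omega>"
    and D: "\<And>x. x \<in> \<Omega> \<Longrightarrow> P *v x + d \<in> D"
    and f: "\<And>x. x \<in> \<Omega> \<Longrightarrow> f x = F (P *v x + d) + q \<bullet> x + c"
  shows "equivalent_to_open_part (graph_over \<Omega> f) (graph_over D F)"
proof -
  let ?Z = "\<lambda>x. P *v x + d"
  have surj: "surj (\<lambda>x. P *v x)"
    using P by (metis invertible_right_inverse matrix_right_invertible_surjective)
  have "?Z ` \<Omega> = (\<lambda>x. d + x) ` ((\<lambda>x. P *v x) ` \<Omega>)" by (auto simp: image_image add.commute)
  then have "open (?Z ` \<Omega>)"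
    using open_surjective_linear_image[OF \<Omega> matrix_vector_mul_linear surj] open_translation by metis
  then have "open (?Z ` \<Omega> \<times> (UNIV :: real set))" by (intro open_Times) auto
  moreover have "graph_over (?Z ` \<Omega>) F = graph_over D F \<inter> (?Z ` \<Omega> \<times> UNIV)"
    using D by (auto simp: graph_over_def)
  ultimately have "openin (top_of_set (graph_over D F)) (graph_over (?Z ` \<Omega>) F)"
    by (simp add: openin_open_Int)
  moreover have "graph_over (?Z ` \<Omega>) F = calabi_map P (- q) (d, - c) ` graph_over \<Omega> f"
    by (auto simp: graph_over_def calabi_map_def image_image f)
  ultimately show ?thesis
    unfolding equivalent_to_open_part_def calabi_affine_equivalent_def using P by blast
qed

text \<open>This allows both cases of the classification to be handled at once, with
  \<open>r = 0\<close> for the paraboloid.\<close>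

lemma Q_hypersurface_0:
  fixes e :: "nat \<Rightarrow> 'n::finite"
  assumes "bij_betw e {1..CARD('n)} UNIV"
  shows "Q_hypersurface e 0 c = elliptic_paraboloid"
proof -
  have eq: "(\<Sum>j = Suc 0..CARD('n). (x $ e j)\<^sup>2 / 2) = (\<Sum>i\<in>UNIV. (x $ i)\<^sup>2) / 2" for x :: "real ^ 'n"
    using sum.reindex_bij_betw[OF assms, of "\<lambda>i. (x $ i)\<^sup>2 / 2"] by (simp add: sum_divide_distrib)
  show ?thesis by (simp add: Q_hypersurface_def elliptic_paraboloid_def eq)
qed

text \<open>The basis vectors with nonzero \<open>m\<close> have to come first, since the logarithms
  in \<open>Q_hypersurface\<close> occupy the first \<open>r\<close> coordinates.\<close>

lemma bij_betw_atLeastAtMost_filter: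
  assumes "finite B"
  obtains \<beta> :: "nat \<Rightarrow> 'a" where "bij_betw \<beta> {1..card B} B"
    "\<And>i. i \<in> {1..card B} \<Longrightarrow> p (\<beta> i) \<longleftrightarrow> i \<le> card {b\<in>B. p b}"
proof -
  let ?B1 = "{b\<in>B. p b}" and ?B0 = "{b\<in>B. \<not> p b}"
  define r where "r = card ?B1"
  have Un: "?B1 \<union> ?B0 = B" by auto
  have "card (?B1 \<union> ?B0) = r + card ?B0"
    unfolding r_def by (rule card_Un_disjoint) (use assms in auto)
  then have cB: "card B = r + card ?B0" by (simp only: Un)
  obtain h1 where h1: "bij_betw h1 {1..r} ?B1"
    using ex_bij_betw_nat_finite_1[of ?B1] assms by (auto simp: r_def)
  obtain h0 where h0: "bij_betw h0 {r+1..card B} ?B0"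
    using finite_same_card_bij[of "{r+1..card B}" ?B0] assms cB by auto
  define \<beta> where "\<beta> i = (if i \<le> r then h1 i else h0 i)" for i
  have b1: "bij_betw \<beta> {1..r} ?B1" using h1 by (rule bij_betw_cong[THEN iffD1, rotated]) (simp add: \<beta>_def)
  have b0: "bij_betw \<beta> {r+1..card B} ?B0" using h0 by (rule bij_betw_cong[THEN iffD1, rotated]) (simp add: \<beta>_def)
  have "bij_betw \<beta> ({1..r} \<union> {r+1..card B}) (?B1 \<union> ?B0)"
    by (rule bij_betw_combine[OF b1 b0]) auto
  moreover have "{1..r} \<union> {r+1..card B} = {1..card B}" using cB by auto
  ultimately have "bij_betw \<beta> {1..card B} B" by (simp only: Un)
  moreover have "p (\<beta> i) \<longleftrightarrow> i \<le> r" if "i \<in> {1..card B}" for i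
    using that bij_betwE[OF b1] bij_betwE[OF b0] by (cases "i \<le> r") auto
  ultimately show ?thesis using that unfolding r_def by blast
qed

subsection \<open>Integration of the metric\<close>

locale pointed_calabi_graph = calabi_graph f \<Omega>
  for f :: "real ^ 'n::finite \<Rightarrow> real" and \<Omega> :: "(real ^ 'n) set" +
  fixes x0 :: "real ^ 'n"
  assumes connected_domain: "connected \<Omega>" and x0: "x0 \<in> \<Omega>"
begin

definition L :: "real ^ 'n \<Rightarrow> real ^ 'n ^ 'n" where "L v = (\<Sum>i\<in>UNIV. v $ i *\<^sub>R \<Gamma> i x0)"

definition E :: "real ^ 'n \<Rightarrow> real ^ 'n ^ 'n" where "E x = mat 1 - L (x - x0)"

lemma linear_L: "linear L"
  by (auto simp: linear_iff L_def algebra_simps sum.distrib scaleR_sum_right)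

lemma L_commute: "L u ** L v = L v ** L u"
proof -
  have 1: "L u ** \<Gamma> j x0 = \<Gamma> j x0 ** L u" for u j
    by (simp add: L_def matrix_sum matrix_scaleR \<Gamma>_commute[OF x0, of _ j])
  have "L u ** L v = (\<Sum>j\<in>UNIV. v $ j *\<^sub>R (L u ** \<Gamma> j x0))"
    by (simp add: L_def[of v] matrix_sum matrix_scaleR)
  also have "\<dots> = L v ** L u"
    unfolding 1 by (simp add: L_def[of v] matrix_sum matrix_scaleR)
  finally show ?thesis .
qed

lemma E_L_commute: "E x ** L v = L v ** E x"
  by (simp add: E_def matrix_diff L_commute)

lemma E_has_derivative: "(E has_derivative (\<lambda>h. - L h)) (at x)"
proof -
  have bl: "bounded_linear L" using linear_L linear_conv_bounded_linear by blast
  show ?thesis unfolding E_def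
    by (rule derivative_eq_intros bounded_linear.has_derivative[OF bl] refl | simp)+
qed

lemma \<Gamma>_has_derivative:
  "x \<in> \<Omega> \<Longrightarrow> (\<Gamma> i has_derivative (\<lambda>h. (\<Sum>l\<in>UNIV. h $ l *\<^sub>R \<Gamma> l x) ** \<Gamma> i x)) (at x)"
  using has_derivative_matrix_partial[of "\<Gamma> i", OF \<Gamma>_differentiable, of x]
  by (simp add: matrix_partial_\<Gamma> matrix_sum matrix_scaleR)

lemma \<Gamma>_E:
  assumes x: "x \<in> \<Omega>" shows "\<Gamma> i x ** E x = \<Gamma> i x0"
proof -
  \<comment> \<open>All indices are bundled into one vector because the system is coupled: the
    derivative of the \<open>i\<close>th difference along \<open>h\<close> is
    \<open>\<Gamma> i\<close> times the combination of all the differences with coefficients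
    \<open>h $ l\<close>.\<close>
  define D :: "real ^ 'n \<Rightarrow> real ^ 'n ^ 'n ^ 'n" where "D = (\<lambda>x. \<chi> i. \<Gamma> i x ** E x - \<Gamma> i x0)"
  let ?D' = "\<lambda>x h. \<chi> i. \<Gamma> i x ** (\<Sum>l\<in>UNIV. h $ l *\<^sub>R D x $ l)"
  obtain K where K: "K > 0" "\<And>(A :: real^'n^'n) (B :: real^'n^'n). norm (A ** B) \<le> norm A * norm B * K"
    using bounded_bilinear.pos_bounded[OF bounded_bilinear_matrix_mult] by blast
  have "D x = 0"
  proof (rule linear_growth_zero_on_connected[OF open_domain connected_domain _ _ _ x0 _ x])
    show "(D has_derivative ?D' y) (at y)" if y: "y \<in> \<Omega>" for y
      unfolding D_def
    proof (rule has_derivative_vec_lambda)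
      fix i
      have "((\<lambda>x. \<Gamma> i x ** E x - \<Gamma> i x0) has_derivative
        (\<lambda>h. (\<Gamma> i y ** (- L h) + ((\<Sum>l\<in>UNIV. h $ l *\<^sub>R \<Gamma> l y) ** \<Gamma> i y) ** E y) - 0)) (at y)"
        by (intro has_derivative_diff has_derivative_const has_derivative_matrix_mult \<Gamma>_has_derivative[OF y] E_has_derivative)
      moreover have "(\<Gamma> i y ** (- L h) + ((\<Sum>l\<in>UNIV. h $ l *\<^sub>R \<Gamma> l y) ** \<Gamma> i y) ** E y) - 0
          = \<Gamma> i y ** (\<Sum>l\<in>UNIV. h $ l *\<^sub>R (\<chi> i. \<Gamma> i y ** E y - \<Gamma> i x0) $ l)" for h
      proof -
        have "(\<Sum>l\<in>UNIV. h $ l *\<^sub>R \<Gamma> l y) ** \<Gamma> i y = \<Gamma> i y ** (\<Sum>l\<in>UNIV. h $ l *\<^sub>R \<Gamma> l y)"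
          by (simp add: matrix_sum matrix_scaleR \<Gamma>_commute[OF y, of _ i])
        then have "(\<Gamma> i y ** (- L h) + ((\<Sum>l\<in>UNIV. h $ l *\<^sub>R \<Gamma> l y) ** \<Gamma> i y) ** E y) - 0
          = \<Gamma> i y ** (- L h + (\<Sum>l\<in>UNIV. h $ l *\<^sub>R \<Gamma> l y) ** E y)"
          by (simp only: diff_0_right matrix_add_ldistrib matrix_mul_assoc)
        also have "- L h + (\<Sum>l\<in>UNIV. h $ l *\<^sub>R \<Gamma> l y) ** E y
            = (\<Sum>l\<in>UNIV. h $ l *\<^sub>R (\<chi> i. \<Gamma> i y ** E y - \<Gamma> i x0) $ l)"
          by (simp add: L_def matrix_sum matrix_scaleR sum_subtractf scaleR_diff_right)
        finally show ?thesis .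
      qed
      ultimately show "((\<lambda>x. \<Gamma> i x ** E x - \<Gamma> i x0) has_derivative
        (\<lambda>h. \<Gamma> i y ** (\<Sum>l\<in>UNIV. h $ l *\<^sub>R (\<chi> i. \<Gamma> i y ** E y - \<Gamma> i x0) $ l))) (at y)" by simp
    qed
    show "norm (?D' y h) \<le> ((\<Sum>i\<in>UNIV. norm (\<Gamma> i y)) * CARD('n) * K) * norm (D y) * norm h" for y h
    proof -
      have "norm (\<Sum>l\<in>UNIV. h $ l *\<^sub>R D y $ l) \<le> (\<Sum>l\<in>(UNIV::'n set). norm h * norm (D y))"
        by (rule order_trans[OF norm_sum sum_mono])
          (simp, intro mult_mono component_le_norm_cart Finite_Cartesian_Product.norm_nth_le, simp_all)
      then have 1: "norm (\<Sum>l\<in>UNIV. h $ l *\<^sub>R D y $ l) \<le> CARD('n) * norm h * norm (D y)" by simp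
      have "norm (?D' y h) \<le> (\<Sum>i\<in>UNIV. norm (\<Gamma> i y ** (\<Sum>l\<in>UNIV. h $ l *\<^sub>R D y $ l)))"
        using L2_set_le_sum[of UNIV "\<lambda>i. norm (?D' y h $ i)"] by (simp add: norm_vec_def)
      also have "\<dots> \<le> (\<Sum>i\<in>UNIV. norm (\<Gamma> i y) * (CARD('n) * norm h * norm (D y)) * K)"
      proof (rule sum_mono)
        fix i
        show "norm (\<Gamma> i y ** (\<Sum>l\<in>UNIV. h $ l *\<^sub>R D y $ l)) \<le> norm (\<Gamma> i y) * (CARD('n) * norm h * norm (D y)) * K"
          using order_trans[OF K(2) mult_right_mono[OF mult_left_mono[OF 1 norm_ge_zero] less_imp_le[OF K(1)]]] .
      qed
      also have "\<dots> = ((\<Sum>i\<in>UNIV. norm (\<Gamma> i y)) * CARD('n) * K) * norm (D y) * norm h"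
        by (simp add: sum_distrib_right sum_distrib_left mult_ac)
      finally show ?thesis .
    qed
    have "continuous_on \<Omega> (\<Gamma> i)" for i
      using \<Gamma>_has_derivative by (meson continuous_at_imp_continuous_on has_derivative_continuous)
    then show "continuous_on \<Omega> (\<lambda>y. (\<Sum>i\<in>UNIV. norm (\<Gamma> i y)) * CARD('n) * K)"
      by (intro continuous_intros)
    show "D x0 = 0"
      by (simp add: D_def E_def linear_0[OF linear_L] vec_eq_iff)
  qed
  then show ?thesis by (simp add: D_def vec_eq_iff)
qed

lemma g_has_derivative:
  "x \<in> \<Omega> \<Longrightarrow> (g has_derivative (\<lambda>h. \<Sum>l\<in>UNIV. h $ l *\<^sub>R C l x)) (at x)"
  using has_derivative_matrix_partial[of g, OF g_differentiable, of x] by (simp add: matrix_partial_g)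

text \<open>The derivative along \<open>h\<close> is
  \<open>2 g \<Gamma>\<^sub>h E\<^sup>2 - 2 g (L h) E\<close>, where \<open>\<Gamma>\<^sub>h\<close>
  combines the \<open>\<Gamma> l\<close> with coefficients \<open>h $ l\<close>; it vanishes because
  \<open>\<Gamma>\<^sub>h E = L h\<close> by \<open>\<Gamma>_E\<close>.\<close>

theorem metric_formula:
  assumes x: "x \<in> \<Omega>" shows "g x ** (E x ** E x) = g x0"
proof -
  have "((\<lambda>y. g y ** (E y ** E y)) has_derivative (\<lambda>h. 0)) (at y)" if y: "y \<in> \<Omega>" for y
  proof -
    have "((\<lambda>y. g y ** (E y ** E y)) has_derivative
      (\<lambda>h. g y ** (E y ** (- L h) + (- L h) ** E y) + (\<Sum>l\<in>UNIV. h $ l *\<^sub>R C l y) ** (E y ** E y))) (at y)"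
      by (intro has_derivative_matrix_mult g_has_derivative[OF y] E_has_derivative)
    moreover have "g y ** (E y ** (- L h) + (- L h) ** E y) + (\<Sum>l\<in>UNIV. h $ l *\<^sub>R C l y) ** (E y ** E y) = 0" for h
    proof -
      have "C l y = 2 *\<^sub>R (g y ** \<Gamma> l y)" for l by (simp add: g_\<Gamma> y)
      then have "(\<Sum>l\<in>UNIV. h $ l *\<^sub>R C l y) = 2 *\<^sub>R (g y ** (\<Sum>l\<in>UNIV. h $ l *\<^sub>R \<Gamma> l y))"
        by (simp add: matrix_sum matrix_scaleR scaleR_sum_right mult.commute)
      then have "(\<Sum>l\<in>UNIV. h $ l *\<^sub>R C l y) ** (E y ** E y)
          = 2 *\<^sub>R (g y ** (((\<Sum>l\<in>UNIV. h $ l *\<^sub>R \<Gamma> l y) ** E y) ** E y))"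
        by (simp add: matrix_scaleR matrix_mul_assoc)
      also have "(\<Sum>l\<in>UNIV. h $ l *\<^sub>R \<Gamma> l y) ** E y = L h"
        by (simp add: matrix_sum matrix_scaleR \<Gamma>_E[OF y] L_def)
      finally have 1: "(\<Sum>l\<in>UNIV. h $ l *\<^sub>R C l y) ** (E y ** E y) = 2 *\<^sub>R (g y ** (L h ** E y))" .
      have "- L h = (- 1) *\<^sub>R L h" by simp
      then have "E y ** (- L h) + (- L h) ** E y = (- 2) *\<^sub>R (L h ** E y)"
        by (simp only: matrix_scaleR E_L_commute flip: scaleR_add_left) simp
      then show ?thesis using 1 by (simp only: matrix_scaleR) simp
    qed
    ultimately show ?thesis by simp
  qed
  then have "g x ** (E x ** E x) = g x0 ** (E x0 ** E x0)"
    by (intro has_derivative_zero_unique_connected[OF open_domain connected_domain _ x x0, of "\<lambda>y. g y ** (E y ** E y)"])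
  then show ?thesis by (simp add: E_def linear_0[OF linear_L])
qed

definition G :: "real ^ 'n \<Rightarrow> real ^ 'n \<Rightarrow> real" where "G u v = u \<bullet> (g x0 *v v)"

definition mul :: "real ^ 'n \<Rightarrow> real ^ 'n \<Rightarrow> real ^ 'n" where "mul u v = L u *v v"

lemma L_transpose_g: "transpose (L u) ** g x0 = g x0 ** L u"
proof -
  have "transpose (L u) = (\<Sum>i\<in>UNIV. u $ i *\<^sub>R transpose (\<Gamma> i x0))"
    by (simp add: L_def transpose_def vec_eq_iff)
  then show ?thesis
    by (simp add: matrix_sum matrix_scaleR \<Gamma>_transpose_g[OF x0] L_def g_\<Gamma>[OF x0])
qed

text \<open>Commutativity is the symmetry of the Christoffel symbols in the lower indices,
  associativity follows from it and \<open>L_commute\<close>, and invariance is the self-adjointness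
  of \<open>L u\<close>.\<close>

sublocale euclidean_frobenius_algebra G mul
proof
  have gs: "transpose (g x0) = g x0" using g_symmetric x0 by blast
  show "bilinear G"
    by (auto simp: bilinear_def linear_iff G_def inner_add matrix_vector_right_distrib matrix_vector_mult_scaleR)
  show "G x y = G y x" for x y
    unfolding G_def by (metis dot_lmul_matrix gs inner_commute transpose_matrix_vector)
  show "x \<noteq> 0 \<Longrightarrow> G x x > 0" for x
    using convex x0 unfolding G_def strictly_convex_on_def positive_definite_def by blast
  show "bilinear mul"
    by (auto simp: bilinear_def linear_iff mul_def linear_add[OF linear_L] linear_scale[OF linear_L]
        matrix_vector_right_distrib matrix_vector_mult_scaleR matrix_vector_mult_add_rdistrib scaleR_matrix_vector_assoc)
  show comm: "mul x y = mul y x" for x y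
  proof -
    have "mul x y $ k = (\<Sum>j\<in>UNIV. \<Sum>i\<in>UNIV. x $ i * \<Gamma> i x0 $ k $ j * y $ j)" for x y k
      by (simp add: mul_def L_def matrix_vector_mult_def sum_distrib_right)
    moreover have "(\<Sum>j\<in>UNIV. \<Sum>i\<in>UNIV. x $ i * \<Gamma> i x0 $ k $ j * y $ j)
      = (\<Sum>j\<in>UNIV. \<Sum>i\<in>UNIV. y $ i * \<Gamma> i x0 $ k $ j * x $ j)" for k
      by (subst sum.swap) (intro sum.cong refl, simp add: \<Gamma>_commute_lower[OF x0] mult_ac)
    ultimately show ?thesis by (simp only: vec_eq_iff) blast
  qed
  show "mul (mul x y) z = mul x (mul y z)" for x y z
  proof -
    have "mul (mul x y) z = L z *v (L x *v y)" using comm[of "L x *v y" z] by (simp add: mul_def)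
    also have "\<dots> = L x *v (L z *v y)" by (simp add: matrix_vector_mul_assoc L_commute)
    also have "\<dots> = mul x (mul y z)" using comm[of y z] by (simp add: mul_def)
    finally show ?thesis .
  qed
  show "G (mul x y) z = G y (mul x z)" for x y z
  proof -
    have "G (mul x y) z = y \<bullet> ((transpose (L x) ** g x0) *v z)"
      unfolding G_def mul_def by (metis dot_lmul_matrix matrix_vector_mul_assoc transpose_matrix_vector transpose_transpose)
    then show ?thesis by (simp add: L_transpose_g G_def mul_def matrix_vector_mul_assoc)
  qed
qed

definition grad :: "real ^ 'n \<Rightarrow> real ^ 'n" where "grad x = (\<chi> k. partial_deriv k f x)"

lemma f_has_derivative: "x \<in> \<Omega> \<Longrightarrow> (f has_derivative (\<lambda>h. grad x \<bullet> h)) (at x)"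
  using differentiable_imp_has_partials[OF differentiable(1), of x]
  by (simp add: grad_def inner_vec_def mult.commute)

lemma grad_has_derivative: "x \<in> \<Omega> \<Longrightarrow> (grad has_derivative (\<lambda>h. g x *v h)) (at x)"
  unfolding grad_def
proof (rule has_derivative_vecI)
  fix i assume x: "x \<in> \<Omega>"
  have "(\<Sum>l\<in>UNIV. h $ l * partial_deriv l (partial_deriv i f) x) = (g x *v h) $ i" for h
    by (simp add: matrix_vector_mult_def g_nth second_commute[OF x, of i] mult.commute)
  then show "((\<lambda>x. (\<chi> k. partial_deriv k f x) $ i) has_derivative (\<lambda>h. (g x *v h) $ i)) (at x)"
    using differentiable_imp_has_partials[OF differentiable(2)[OF x], of i] by simp
qed

lemma G_has_derivative: "((\<lambda>x. G (x - x0) b) has_derivative (\<lambda>h. G h b)) (at x)"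
  unfolding G_def by (rule derivative_eq_intros refl | simp)+

text \<open>An explicit function \<open>H\<close> with the Hessian of \<open>f\<close> is built from
  the split basis. On the connected domain the two differ by an affine function, which a Calabi map
  absorbs.\<close>

theorem normal_form:
  fixes e :: "nat \<Rightarrow> 'n"
  assumes e: "bij_betw e {1..CARD('n)} UNIV"
  shows "\<exists>r c. r \<le> CARD('n) \<and> (\<forall>i\<in>{1..r}. c i > 0) \<and>
    equivalent_to_open_part (graph_over \<Omega> f) (Q_hypersurface e r c)"
proof -
  obtain B where B: "finite B" "span B = UNIV" "\<And>a b. a \<in> B \<Longrightarrow> b \<in> B \<Longrightarrow> G a b = (if a = b then 1 else 0)"
    and Bmul: "\<And>a b. a \<in> B \<Longrightarrow> b \<in> B \<Longrightarrow> a \<noteq> b \<Longrightarrow> mul a b = 0"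
    using exists_orthonormal_splitting[OF subspace_UNIV] by auto
  note expansion = orthonormal_expansion[OF B]
  have cardB: "card B = CARD('n)" using card_orthonormal[OF B] by simp
  define m where "m b = G (mul b b) b" for b
  \<comment> \<open>The coefficient of \<open>mul v b\<close> at \<open>a\<close> is
    \<open>G v (mul b a)\<close> by invariance, and this is zero unless
    \<open>a = b\<close>.\<close>
  have mul_basis: "mul v b = (m b * G v b) *\<^sub>R b" if b: "b \<in> B" for v b
  proof -
    have *: "mul b a = (if a = b then m b *\<^sub>R b else 0)" if a: "a \<in> B" for a
    proof (cases "a = b")
      case True
      have "G (mul b b) b' = (if b' = b then m b else 0)" if "b' \<in> B" for b'
        using Bmul[OF b that] by (auto simp: m_def invariant G_simps)
      then show ?thesis
        using expansion[of "mul b b"] B(1) b True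
        by (simp add: if_distrib[where f="\<lambda>t. t *\<^sub>R _"] cong: if_cong)
    qed (use Bmul a b in auto)
    have "G (mul v b) a = (if a = b then m b * G v b else 0)" if "a \<in> B" for a
      using *[OF that] by (simp add: mul_comm[of v b] invariant[of b v] G_simps)
    then show ?thesis
      using expansion[of "mul v b"] B(1) b by (simp add: if_distrib[where f="\<lambda>t. t *\<^sub>R _"] cong: if_cong)
  qed
  define y where "y b x = G (x - x0) b" for b x
  define z where "z b x = 1 - m b * y b x" for b x
  have E_basis: "E x *v b = z b x *\<^sub>R b" if "b \<in> B" for x b
    using mul_basis[OF that, of "x - x0"]
    by (simp add: E_def z_def y_def mul_def matrix_vector_mult_diff_rdistrib algebra_simps)
  \<comment> \<open>Apply \<open>metric_formula\<close> to \<open>b\<close>, an eigenvector of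
    \<open>E x\<close> with eigenvalue \<open>z b x\<close>.\<close>
  have g_basis: "(z b x)\<^sup>2 *\<^sub>R (g x *v b) = g x0 *v b" if "b \<in> B" "x \<in> \<Omega>" for b x
  proof -
    have "g x0 *v b = g x *v (E x *v (E x *v b))"
      by (simp add: matrix_vector_mul_assoc metric_formula[OF that(2)])
    then show ?thesis
      by (simp add: E_basis[OF that(1)] matrix_vector_mult_scaleR power2_eq_square)
  qed
  have z_nonzero: "z b x \<noteq> 0" if "b \<in> B" "x \<in> \<Omega>" for b x
  proof
    assume "z b x = 0"
    then have "G b b = 0" using g_basis[OF that] by (simp add: G_def)
    then show False using B(3)[OF that(1,1)] by simp
  qed
  \<comment> \<open>The function \<open>z b\<close> is 1 at \<open>x0\<close> and has no zero on the
    connected domain.\<close>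
  have z_pos: "z b x > 0" if b: "b \<in> B" and x: "x \<in> \<Omega>" for b x
  proof (rule ccontr)
    assume "\<not> z b x > 0"
    moreover have "continuous_on \<Omega> (z b)" unfolding z_def y_def by (intro continuous_intros)
    then have "connected (z b ` \<Omega>)" using connected_domain connected_continuous_image by blast
    then have "{z b x..z b x0} \<subseteq> z b ` \<Omega>" using x x0 by (intro connected_contains_Icc) auto
    moreover have "z b x0 = 1" by (simp add: z_def y_def G_simps)
    ultimately have "0 \<in> z b ` \<Omega>" by auto
    then show False using z_nonzero[OF b] by auto
  qed
  \<comment> \<open>A second antiderivative of \<open>1 / (1 - m b * t)\<^sup>2\<close>, with
    \<open>\<psi>'\<close> as the first one. The constants of integration are arbitrary:
    \<open>q\<close> and \<open>c0\<close> compensate for them.\<close>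
  define \<psi> where "\<psi> b t = (if m b = 0 then t\<^sup>2 / 2 else - (1 / (m b)\<^sup>2) * ln (1 - m b * t))" for b t
  define \<psi>' where "\<psi>' b t = (if m b = 0 then t else 1 / (m b * (1 - m b * t)))" for b t
  define H where "H x = (\<Sum>b\<in>B. \<psi> b (y b x))" for x
  define gradH where "gradH x = (\<Sum>b\<in>B. \<psi>' b (y b x) *\<^sub>R (g x0 *v b))" for x
  have y_der: "(y b has_derivative (\<lambda>h. G h b)) (at x)" for b x
    unfolding y_def by (rule G_has_derivative)
  have H_der: "(H has_derivative (\<lambda>h. gradH x \<bullet> h)) (at x)" if x: "x \<in> \<Omega>" for x
  proof -
    have "((\<lambda>x. \<psi> b (y b x)) has_derivative (\<lambda>h. \<psi>' b (y b x) * G h b)) (at x)" if "b \<in> B" for b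
    proof -
      have "((\<psi> b) has_real_derivative \<psi>' b (y b x)) (at (y b x))"
        using z_pos[OF that x] unfolding \<psi>_def \<psi>'_def z_def
        by (cases "m b = 0") (auto intro!: derivative_eq_intros simp: field_simps power2_eq_square)
      then show ?thesis
        using has_derivative_compose[OF y_der] by (simp add: has_field_derivative_def)
    qed
    then have "(H has_derivative (\<lambda>h. \<Sum>b\<in>B. \<psi>' b (y b x) * G h b)) (at x)"
      unfolding H_def by (rule has_derivative_sum)
    then show ?thesis by (simp add: gradH_def inner_sum_right G_def inner_commute)
  qed
  \<comment> \<open>By \<open>g_basis\<close> the second derivative of \<open>\<psi> b\<close> turns
    \<open>g x0 *v b\<close> into \<open>g x *v b\<close>, and summing over the orthonormal basis
    recovers \<open>g x *v h\<close>.\<close>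
  have gradH_der: "(gradH has_derivative (\<lambda>h. g x *v h)) (at x)" if x: "x \<in> \<Omega>" for x
  proof -
    have "((\<lambda>x. \<psi>' b (y b x) *\<^sub>R (g x0 *v b)) has_derivative (\<lambda>h. G h b *\<^sub>R (g x *v b))) (at x)" if b: "b \<in> B" for b
    proof -
      have "((\<psi>' b) has_real_derivative 1 / (z b x)\<^sup>2) (at (y b x))"
        using z_pos[OF b x] unfolding \<psi>'_def z_def
        by (cases "m b = 0") (auto intro!: derivative_eq_intros simp: power2_eq_square)
      then have "(\<psi>' b has_derivative (*) (1 / (z b x)\<^sup>2)) (at (y b x))"
        by (simp only: has_field_derivative_def)
      then have "((\<lambda>x. \<psi>' b (y b x)) has_derivative (\<lambda>h. 1 / (z b x)\<^sup>2 * G h b)) (at x)"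
        by (rule has_derivative_compose[OF y_der])
      then have "((\<lambda>x. \<psi>' b (y b x) *\<^sub>R (g x0 *v b)) has_derivative
        (\<lambda>h. (1 / (z b x)\<^sup>2 * G h b) *\<^sub>R (g x0 *v b))) (at x)"
        by (rule has_derivative_scaleR_left)
      moreover have "(1 / (z b x)\<^sup>2 * G h b) *\<^sub>R (g x0 *v b) = G h b *\<^sub>R (g x *v b)" for h
        using z_nonzero[OF b x] by (simp flip: g_basis[OF b x])
      ultimately show ?thesis by simp
    qed
    then have "(gradH has_derivative (\<lambda>h. \<Sum>b\<in>B. G h b *\<^sub>R (g x *v b))) (at x)"
      unfolding gradH_def by (rule has_derivative_sum)
    moreover have "(\<Sum>b\<in>B. G h b *\<^sub>R (g x *v b)) = g x *v h" for h
    proof -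
      have "g x *v h = g x *v (\<Sum>b\<in>B. G h b *\<^sub>R b)" using expansion[of h] by simp
      then show ?thesis
        by (simp add: linear_sum[OF matrix_vector_mul_linear] matrix_vector_mult_scaleR)
    qed
    ultimately show ?thesis by simp
  qed
  define q where "q = grad x0 - gradH x0"
  define c0 where "c0 = f x0 - H x0 - q \<bullet> x0"
  have q: "grad x - gradH x = q" if x: "x \<in> \<Omega>" for x
  proof -
    have "((\<lambda>x. grad x - gradH x) has_derivative (\<lambda>h. 0)) (at y)" if "y \<in> \<Omega>" for y
      using has_derivative_diff[OF grad_has_derivative[OF that] gradH_der[OF that]] by simp
    then show ?thesis unfolding q_def
      by (intro has_derivative_zero_unique_connected[OF open_domain connected_domain _ x x0, of "\<lambda>x. grad x - gradH x"])
  qed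
  have f_eq: "f x = H x + q \<bullet> x + c0" if x: "x \<in> \<Omega>" for x
  proof -
    have "((\<lambda>x. f x - H x - q \<bullet> x) has_derivative (\<lambda>h. 0)) (at y)" if y: "y \<in> \<Omega>" for y
    proof -
      have "((\<lambda>x. f x - H x - q \<bullet> x) has_derivative (\<lambda>h. grad y \<bullet> h - gradH y \<bullet> h - q \<bullet> h)) (at y)"
        by (intro has_derivative_diff f_has_derivative[OF y] H_der[OF y] has_derivative_inner_right has_derivative_ident)
      then show ?thesis by (simp flip: q[OF y] add: inner_diff_left)
    qed
    then have "f x - H x - q \<bullet> x = c0" unfolding c0_def
      by (intro has_derivative_zero_unique_connected[OF open_domain connected_domain _ x x0, of "\<lambda>x. f x - H x - q \<bullet> x"])
    then show ?thesis by simp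
  qed
  obtain \<beta> where \<beta>: "bij_betw \<beta> {1..CARD('n)} B"
    and \<beta>m: "\<And>i. i \<in> {1..CARD('n)} \<Longrightarrow> m (\<beta> i) \<noteq> 0 \<longleftrightarrow> i \<le> card {b\<in>B. m b \<noteq> 0}"
    using bij_betw_atLeastAtMost_filter[OF B(1), of "\<lambda>b. m b \<noteq> 0"] unfolding cardB by blast
  define r where "r = card {b\<in>B. m b \<noteq> 0}"
  define c where "c i = 1 / (m (\<beta> i))\<^sup>2" for i
  have r: "r \<le> CARD('n)" unfolding r_def cardB[symmetric] by (rule card_mono[OF B(1)]) auto
  \<comment> \<open>The basis vector assigned to the coordinate \<open>a\<close>: both carry the
    same number, under \<open>\<beta>\<close> and \<open>e\<close> respectively.\<close>
  define \<sigma> where "\<sigma> a = \<beta> (inv_into {1..CARD('n)} e a)" for a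
  have \<sigma>e: "\<sigma> (e i) = \<beta> i" if "i \<in> {1..CARD('n)}" for i
    using that e by (simp add: \<sigma>_def bij_betw_inv_into_left)
  have \<sigma>B: "\<sigma> ` UNIV = B"
  proof -
    have "bij_betw (\<beta> \<circ> inv_into {1..CARD('n)} e) UNIV B"
      using bij_betw_trans[OF bij_betw_inv_into[OF e] \<beta>] .
    then show ?thesis by (auto simp: bij_betw_def \<sigma>_def)
  qed
  \<comment> \<open>The new coordinate is \<open>z b\<close>, with slope \<open>- m b\<close> in
    \<open>y b\<close> and constant 1, if \<open>m b\<close> is nonzero, and \<open>y b\<close>
    itself otherwise. Accordingly \<open>s\<close> supplies the slopes for \<open>P\<close>, and
    \<open>d\<close> the constants, corrected by \<open>P *v x0\<close>.\<close>
  define s where "s b = (if m b = 0 then 1 else - m b)" for b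
  define P :: "real ^ 'n ^ 'n" where "P = (\<chi> a. s (\<sigma> a) *\<^sub>R (g x0 *v \<sigma> a))"
  define d :: "real ^ 'n" where "d = (\<chi> a. if m (\<sigma> a) = 0 then 0 else 1) - P *v x0"
  have Pv: "(P *v v) $ a = s (\<sigma> a) * G v (\<sigma> a)" for v a
    by (simp add: P_def matrix_vector_mul_component G_def inner_commute)
  \<comment> \<open>All slopes are nonzero, so a vector in the kernel of \<open>P\<close> is
    orthogonal to the whole basis.\<close>
  have invP: "invertible P"
  proof -
    have "v = 0" if "P *v v = 0" for v
    proof -
      have "G v b = 0" if "b \<in> B" for b
      proof -
        obtain a where "b = \<sigma> a" using \<sigma>B \<open>b \<in> B\<close> by blast
        then show ?thesis using Pv[of v a] \<open>P *v v = 0\<close> by (auto simp: s_def split: if_splits)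
      qed
      then show ?thesis using expansion[of v] by simp
    qed
    then show ?thesis using matrix_left_invertible_ker[of P] invertible_left_inverse[of P] by blast
  qed
  have Z: "(P *v x + d) $ e i = (if i \<le> r then z (\<beta> i) x else y (\<beta> i) x)" if "i \<in> {1..CARD('n)}" for x i
  proof -
    have "(P *v x + d) $ e i = (P *v (x - x0)) $ e i + (if m (\<beta> i) = 0 then 0 else 1)"
      by (simp add: d_def \<sigma>e[OF that] matrix_vector_mult_diff_distrib)
    then show ?thesis
      using \<beta>m[OF that] by (auto simp: Pv \<sigma>e[OF that] s_def z_def y_def r_def)
  qed
  let ?D = "{x :: real ^ 'n. \<forall>i\<in>{1..r}. x $ e i > 0}"
  let ?F = "\<lambda>x :: real ^ 'n. - (\<Sum>i=1..r. c i * ln (x $ e i)) + (\<Sum>j=r+1..CARD('n). 1/2 * (x $ e j)\<^sup>2)"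
  have H_eq: "H x = ?F (P *v x + d)" for x
  proof -
    have "H x = (\<Sum>i=1..CARD('n). \<psi> (\<beta> i) (y (\<beta> i) x))"
      unfolding H_def using sum.reindex_bij_betw[OF \<beta>, of "\<lambda>b. \<psi> b (y b x)"] by simp
    also have "{1..CARD('n)} = {1..r} \<union> {r+1..CARD('n)}" using r by auto
    also have "(\<Sum>i\<in>{1..r} \<union> {r+1..CARD('n)}. \<psi> (\<beta> i) (y (\<beta> i) x)) =
        (\<Sum>i=1..r. \<psi> (\<beta> i) (y (\<beta> i) x)) + (\<Sum>i=r+1..CARD('n). \<psi> (\<beta> i) (y (\<beta> i) x))"
      by (rule sum.union_disjoint) auto
    also have "(\<Sum>i=1..r. \<psi> (\<beta> i) (y (\<beta> i) x)) = (\<Sum>i=1..r. - (c i * ln ((P *v x + d) $ e i)))"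
    proof (rule sum.cong[OF refl])
      fix i assume i: "i \<in> {1..r}"
      then have i': "i \<in> {1..CARD('n)}" using r by auto
      show "\<psi> (\<beta> i) (y (\<beta> i) x) = - (c i * ln ((P *v x + d) $ e i))"
        using i \<beta>m[OF i'] unfolding Z[OF i'] by (simp add: \<psi>_def c_def z_def r_def)
    qed
    also have "(\<Sum>i=r+1..CARD('n). \<psi> (\<beta> i) (y (\<beta> i) x)) = (\<Sum>i=r+1..CARD('n). 1/2 * ((P *v x + d) $ e i)\<^sup>2)"
    proof (rule sum.cong[OF refl])
      fix i assume i: "i \<in> {r+1..CARD('n)}"
      then have i': "i \<in> {1..CARD('n)}" by auto
      show "\<psi> (\<beta> i) (y (\<beta> i) x) = 1/2 * ((P *v x + d) $ e i)\<^sup>2"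
        using i \<beta>m[OF i'] unfolding Z[OF i'] by (simp add: \<psi>_def r_def)
    qed
    finally show ?thesis by (simp only: sum_negf)
  qed
  have "equivalent_to_open_part (graph_over \<Omega> f) (graph_over ?D ?F)"
  proof (rule equivalent_to_open_part_graph[OF invP open_domain])
    show "P *v x + d \<in> ?D" if x: "x \<in> \<Omega>" for x
    proof (intro CollectI ballI)
      fix i assume i: "i \<in> {1..r}"
      then have i': "i \<in> {1..CARD('n)}" using r by auto
      then have "\<beta> i \<in> B" using \<beta> bij_betwE by blast
      then show "0 < (P *v x + d) $ e i" unfolding Z[OF i'] using i z_pos x by simp
    qed
    show "f x = ?F (P *v x + d) + q \<bullet> x + c0" if "x \<in> \<Omega>" for x
      using f_eq[OF that] by (simp only: H_eq)
  qed
  moreover have "c i > 0" if "i \<in> {1..r}" for i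
    using that \<beta>m[of i] r by (auto simp: c_def r_def)
  ultimately show ?thesis using r unfolding Q_hypersurface_def by blast
qed

end

theorem theorem1p3:
  fixes f :: "real ^ 'n::finite \<Rightarrow> real" and \<Omega> :: "(real ^ 'n) set" and e :: "nat \<Rightarrow> 'n"
  assumes numbering: "bij_betw e {1..CARD('n)} UNIV"
    and domain: "is_domain \<Omega>"
    and smooth: "smooth_fun_on f \<Omega>"
    and convex: "strictly_convex_on f \<Omega>"
    and flat: "flat_metric_on (calabi_metric f) \<Omega>"
    and parallel: "parallel3_on (calabi_metric f) (cubic_form f) \<Omega>"
  shows "equivalent_to_open_part (graph_over \<Omega> f) elliptic_paraboloid \<or>
    (\<exists>r c. 1 \<le> r \<and> r \<le> CARD('n) \<and> (\<forall>i\<in>{1..r}. c i > 0) \<and>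
       equivalent_to_open_part (graph_over \<Omega> f) (Q_hypersurface e r c))"
proof -
  obtain x0 where "x0 \<in> \<Omega>" using domain by (auto simp: is_domain_def)
  then interpret pointed_calabi_graph f \<Omega> x0
    using assms by unfold_locales (auto simp: is_domain_def)
  obtain r c where rc: "r \<le> CARD('n)" "\<forall>i\<in>{1..r}. c i > 0"
    "equivalent_to_open_part (graph_over \<Omega> f) (Q_hypersurface e r c)"
    using normal_form[OF numbering] by blast
  show ?thesis
  proof (cases "r = 0")
    case True
    then show ?thesis using rc(3) Q_hypersurface_0[OF numbering] by metis
  next
    case False
    then have "1 \<le> r" by simp
    then show ?thesis using rc by blast
  qed
qed

end
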